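(* Let $T=(V,E,o)$ be a rooted tree in which every vertex has (finite) degree at least $3$. For $r\ge 0$ let $\ell_r(T)$ be the set of vertices at graph distance $r$ from the root $o$, and let $d_v$ denote the degree of $v$. If there exist $C>0$ and $1\le a<\sqrt{4/3}$ such that $\max_{v\in \ell_r(T)} d_v\le C a^r$ for all $r\ge 0$, then almost surely $T_3(T)$ has an infinite connected component.
   Context: Layers model: given a graph $G=(V,E)$, let $(X_v)_{v\in V}$ be i.i.d. Uniform$[0,1]$ random variables ("ages"; $u$ is younger than $v$ if $X_u<X_v$). For an integer $k\ge1$, $T_k(G)$ is the (random) set of vertices $v$ having at most $k-1$ neighbors $u$ with $X_u<X_v$; $T_k(G)$ also denotes the subgraph of $G$ induced on this set. *)

theory Defs
  imports "HOL-Probability.Probability"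
begin

text \<open>
  A graph is given by its vertex set \<open>V\<close> and its set \<open>E\<close> of edges, each edge being the
  two-element set of its endpoints. Both may be infinite.
\<close>

definition simple_graph :: "'a set \<Rightarrow> 'a set set \<Rightarrow> bool" where
  "simple_graph V E \<longleftrightarrow> (\<forall>e\<in>E. \<exists>u\<in>V. \<exists>v\<in>V. u \<noteq> v \<and> e = {u, v})"

definition neighbours :: "'a set set \<Rightarrow> 'a \<Rightarrow> 'a set" where
  "neighbours E v = {u. {u, v} \<in> E}"

definition vertex_degree :: "'a set set \<Rightarrow> 'a \<Rightarrow> nat" where
  "vertex_degree E v = card (neighbours E v)"

text \<open>A walk is the list of its vertices; it has one edge fewer than entries.\<close>

definition walk :: "'a set \<Rightarrow> 'a set set \<Rightarrow> 'a list \<Rightarrow> bool" where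
  "walk V E p \<longleftrightarrow> p \<noteq> [] \<and> set p \<subseteq> V \<and>
     (\<forall>i. Suc i < length p \<longrightarrow> {p ! i, p ! Suc i} \<in> E)"

definition walk_between :: "'a set \<Rightarrow> 'a set set \<Rightarrow> 'a \<Rightarrow> 'a list \<Rightarrow> 'a \<Rightarrow> bool" where
  "walk_between V E u p v \<longleftrightarrow> walk V E p \<and> hd p = u \<and> last p = v"

definition connected_graph :: "'a set \<Rightarrow> 'a set set \<Rightarrow> bool" where
  "connected_graph V E \<longleftrightarrow> V \<noteq> {} \<and> (\<forall>u\<in>V. \<forall>v\<in>V. \<exists>p. walk_between V E u p v)"

text \<open>A cycle lists its vertices once; the closing edge joins the last one to the first.\<close>

definition cycle :: "'a set \<Rightarrow> 'a set set \<Rightarrow> 'a list \<Rightarrow> bool" where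
  "cycle V E p \<longleftrightarrow> walk V E p \<and> distinct p \<and> 3 \<le> length p \<and> {last p, hd p} \<in> E"

definition tree :: "'a set \<Rightarrow> 'a set set \<Rightarrow> bool" where
  "tree V E \<longleftrightarrow> simple_graph V E \<and> connected_graph V E \<and> (\<nexists>p. cycle V E p)"

definition rooted_tree :: "'a set \<Rightarrow> 'a set set \<Rightarrow> 'a \<Rightarrow> bool" where
  "rooted_tree V E \<rho> \<longleftrightarrow> tree V E \<and> \<rho> \<in> V"

text \<open>The distance is meaningful only for vertices joined by a walk.\<close>

definition graph_dist :: "'a set \<Rightarrow> 'a set set \<Rightarrow> 'a \<Rightarrow> 'a \<Rightarrow> nat" where
  "graph_dist V E u v = (LEAST n. \<exists>p. walk_between V E u p v \<and> length p = Suc n)"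

definition level :: "'a set \<Rightarrow> 'a set set \<Rightarrow> 'a \<Rightarrow> nat \<Rightarrow> 'a set" where
  "level V E \<rho> r = {v \<in> V. graph_dist V E \<rho> v = r}"

definition induced_edges :: "'a set set \<Rightarrow> 'a set \<Rightarrow> 'a set set" where
  "induced_edges E W = {e \<in> E. e \<subseteq> W}"

definition graph_components :: "'a set \<Rightarrow> 'a set set \<Rightarrow> 'a set set" where
  "graph_components V E = (\<lambda>v. {u. \<exists>p. walk_between V E v p u}) ` V"

text \<open>
  The vertex set of \<open>T\<^sub>k\<close> for the ages \<open>x\<close>, meant for \<open>k \<ge> 1\<close>. Finiteness is demanded
  explicitly because \<^const>\<open>card\<close> is \<open>0\<close> on infinite sets.
\<close>

definition layers :: "'a set \<Rightarrow> 'a set set \<Rightarrow> nat \<Rightarrow> ('a \<Rightarrow> real) \<Rightarrow> 'a set" where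
  "layers V E k x =
     {v \<in> V. finite {u \<in> neighbours E v. x u < x v} \<and>
             card {u \<in> neighbours E v. x u < x v} \<le> k - 1}"

definition iid_uniform :: "'b measure \<Rightarrow> 'a set \<Rightarrow> ('a \<Rightarrow> 'b \<Rightarrow> real) \<Rightarrow> bool" where
  "iid_uniform M V X \<longleftrightarrow>
     prob_space.indep_vars M (\<lambda>_. borel) X V \<and>
     (\<forall>v\<in>V. distr M borel (X v) = uniform_measure lborel {0..1})"

end

theory Submission
  imports Defs
begin

text \<open>
  Cut a descending path into consecutive pairs \<open>v, u\<close> followed by a child \<open>w\<close> of \<open>u\<close>. Among two
  adjacent vertices only one can be the younger, so if the two have no younger children off the
  path, or a single one in total, belonging to the younger of the two, then both lie in the
  third layer whatever the ages of the parent of \<open>v\<close> and of \<open>w\<close>. With \<open>b\<close> denoting numbers of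
  children, this event has probability at least \<open>(4/3) / (b v * b u)\<close>, and it is independent of
  the ages in the subtree of \<open>w\<close>. Hence the weighted number of surviving paths below \<open>v\<close>,
  normalised to mean \<open>1\<close>, satisfies a recursion in which two generations multiply the second
  moment by at most \<open>3/4\<close> and add a multiple of the degrees; as \<open>(3/4) * a^2 < 1\<close>, the second
  moment is \<open>O(a^r)\<close> for \<open>v\<close> at distance \<open>r\<close> from the root. So \<open>v\<close> survives with probability at
  least \<open>c / a^r\<close>, independently for the at least \<open>2^r\<close> vertices at distance \<open>r\<close>. Since
  \<open>a < 2\<close>, almost surely some vertex survives.
\<close>

section \<open>Events depending on finitely many ages\<close>

text \<open>Measurability over \<open>PiM S\<close> concerns only functions that are
  \<open>undefined\<close> outside \<open>S\<close>. The second conjunct carries \<open>Q\<close>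
  over to arbitrary age functions, so that all events are predicates on one type, whatever
  \<open>S\<close> is.\<close>

definition local_event :: "'a set \<Rightarrow> (('a \<Rightarrow> real) \<Rightarrow> bool) \<Rightarrow> bool" where
  "local_event S Q \<longleftrightarrow>
     Measurable.pred (PiM S (\<lambda>_. borel)) Q \<and> (\<forall>x. Q (restrict x S) = Q x)"

text \<open>Boundedness is built in so that integrability comes for free.\<close>

definition local_fun :: "'a set \<Rightarrow> (('a \<Rightarrow> real) \<Rightarrow> real) \<Rightarrow> bool" where
  "local_fun S f \<longleftrightarrow>
     f \<in> borel_measurable (PiM S (\<lambda>_. borel)) \<and> (\<forall>x. f (restrict x S) = f x) \<and>
     (\<exists>B. \<forall>x. \<bar>f x\<bar> \<le> B)"

text \<open>\<open>Q\<close> factors through restriction to \<open>S\<close>, a measurable map from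
  the product over \<open>T\<close> to the product over \<open>S\<close>.\<close>

lemma local_event_mono:
  assumes "local_event S Q" "S \<subseteq> T"
  shows "local_event T Q"
proof -
  have "Q = (\<lambda>x. Q (restrict x S))"
    using assms by (auto simp: local_event_def)
  moreover have "Measurable.pred (PiM T (\<lambda>_. borel)) (\<lambda>x. Q (restrict x S))"
    using assms by (intro measurable_compose[OF measurable_restrict_subset])
      (auto simp: local_event_def)
  moreover have "Q (restrict x T) = Q x" for x
  proof -
    have "Q (restrict x T) = Q (restrict (restrict x T) S)"
      using assms(1) unfolding local_event_def by metis
    also have "restrict (restrict x T) S = restrict x S"
      using assms(2) by (auto simp: restrict_def fun_eq_iff)
    also have "Q (restrict x S) = Q x"
      using assms(1) unfolding local_event_def by blast
    finally show ?thesis .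
  qed
  ultimately show ?thesis
    by (simp add: local_event_def)
qed

lemma local_fun_mono:
  assumes "local_fun S f" "S \<subseteq> T"
  shows "local_fun T f"
proof -
  have "f = (\<lambda>x. f (restrict x S))"
    using assms by (auto simp: local_fun_def)
  moreover have "(\<lambda>x. f (restrict x S)) \<in> borel_measurable (PiM T (\<lambda>_. borel))"
    using assms by (intro measurable_compose[OF measurable_restrict_subset])
      (auto simp: local_fun_def)
  moreover have "f (restrict x T) = f x" for x
  proof -
    have "f (restrict x T) = f (restrict (restrict x T) S)"
      using assms(1) unfolding local_fun_def by metis
    also have "restrict (restrict x T) S = restrict x S"
      using assms(2) by (auto simp: restrict_def fun_eq_iff)
    also have "f (restrict x S) = f x"
      using assms(1) unfolding local_fun_def by blast
    finally show ?thesis .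
  qed
  ultimately show ?thesis
    using assms by (simp add: local_fun_def)
qed

lemma local_event_conj:
  "local_event S Q \<Longrightarrow> local_event S R \<Longrightarrow> local_event S (\<lambda>x. Q x \<and> R x)"
  unfolding local_event_def by (intro conjI pred_intros_logic allI) simp_all

lemma local_event_disj:
  "local_event S Q \<Longrightarrow> local_event S R \<Longrightarrow> local_event S (\<lambda>x. Q x \<or> R x)"
  unfolding local_event_def by (intro conjI pred_intros_logic allI) simp_all

lemma local_event_not: "local_event S Q \<Longrightarrow> local_event S (\<lambda>x. \<not> Q x)"
  unfolding local_event_def by (intro conjI pred_intros_logic allI) simp_all

lemma local_event_const: "local_event S (\<lambda>x. P)"
  by (auto simp: local_event_def)

lemma local_event_ball:
  "finite F \<Longrightarrow> (\<And>j. j \<in> F \<Longrightarrow> local_event S (Q j)) \<Longrightarrow> local_event S (\<lambda>x. \<forall>j\<in>F. Q j x)"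
  unfolding local_event_def by (intro conjI pred_intros_finite allI) simp_all

lemma local_event_bex:
  "finite F \<Longrightarrow> (\<And>j. j \<in> F \<Longrightarrow> local_event S (Q j)) \<Longrightarrow> local_event S (\<lambda>x. \<exists>j\<in>F. Q j x)"
  unfolding local_event_def by (intro conjI pred_intros_finite allI) simp_all

lemma local_event_less: "i \<in> S \<Longrightarrow> j \<in> S \<Longrightarrow> local_event S (\<lambda>x. x i < x j)"
  unfolding local_event_def by (auto intro!: borel_measurable_pred_less)

lemma local_event_gt: "j \<in> S \<Longrightarrow> local_event S (\<lambda>x. t < x j)"
  unfolding local_event_def by (auto intro!: borel_measurable_pred_less)

lemmas local_event_intros = local_event_conj local_event_disj local_event_not
  local_event_const local_event_ball local_event_bex local_event_less local_event_gt

lemma local_fun_const: "local_fun S (\<lambda>x. c)"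
  by (auto simp: local_fun_def)

lemma local_fun_of_bool: "local_event S Q \<Longrightarrow> local_fun S (\<lambda>x. of_bool (Q x))"
  unfolding local_fun_def local_event_def
  by (intro conjI allI exI[of _ 1] measurable_compose[OF _ measurable_of_bool]) simp_all

lemma local_fun_mult:
  assumes "local_fun S f" "local_fun S g"
  shows "local_fun S (\<lambda>x. f x * g x)"
proof -
  obtain B B' where B: "\<bar>f x\<bar> \<le> B" "\<bar>g x\<bar> \<le> B'" for x
    using assms unfolding local_fun_def by blast
  have "\<bar>f x * g x\<bar> \<le> B * B'" for x
    unfolding abs_mult using B[of x] by (intro mult_mono) (auto intro: order_trans[OF abs_ge_zero])
  then show ?thesis
    using assms unfolding local_fun_def by (auto intro!: exI[of _ "B * B'"])
qed

lemma local_fun_add: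
  assumes "local_fun S f" "local_fun S g"
  shows "local_fun S (\<lambda>x. f x + g x)"
proof -
  obtain B B' where B: "\<bar>f x\<bar> \<le> B" "\<bar>g x\<bar> \<le> B'" for x
    using assms unfolding local_fun_def by blast
  have "\<bar>f x + g x\<bar> \<le> B + B'" for x
    using B[of x] by linarith
  then show ?thesis
    using assms unfolding local_fun_def by (auto intro!: exI[of _ "B + B'"])
qed

lemma local_fun_sum:
  "(\<And>j. j \<in> F \<Longrightarrow> local_fun S (f j)) \<Longrightarrow> local_fun S (\<lambda>x. \<Sum>j\<in>F. f j x)"
proof (induction F rule: infinite_finite_induct)
  case (insert j F)
  then show ?case
    using local_fun_add[of S "f j" "\<lambda>x. \<Sum>j\<in>F. f j x"] by simp
qed (simp_all add: local_fun_const)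

lemma local_event_pos:
  "local_fun S f \<Longrightarrow> local_event S (\<lambda>x. 0 < f x)"
  unfolding local_fun_def local_event_def
  by (intro conjI borel_measurable_pred_less allI) simp_all

section \<open>Expectations and probabilities under independent uniform ages\<close>

locale uniform_ages = prob_space M
  for M :: "'b measure" and V :: "'a set" and X :: "'a \<Rightarrow> 'b \<Rightarrow> real" +
  assumes indep: "indep_vars (\<lambda>_. borel) X V"
    and uniform: "v \<in> V \<Longrightarrow> distr M borel (X v) = uniform_measure lborel {0..1}"
begin

definition mean :: "(('a \<Rightarrow> real) \<Rightarrow> real) \<Rightarrow> real" where
  "mean f = (\<integral>\<omega>. f (\<lambda>i. X i \<omega>) \<partial>M)"

definition pr :: "(('a \<Rightarrow> real) \<Rightarrow> bool) \<Rightarrow> real" where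
  "pr Q = measure M {\<omega> \<in> space M. Q (\<lambda>i. X i \<omega>)}"

lemma measurable_restrict_ages:
  "S \<subseteq> V \<Longrightarrow> (\<lambda>\<omega>. restrict (\<lambda>i. X i \<omega>) S) \<in> measurable M (PiM S (\<lambda>_. borel))"
  using indep by (intro measurable_restrict) (auto simp: indep_vars_def)

lemma local_fun_measurable:
  assumes "local_fun S f" "S \<subseteq> V"
  shows "(\<lambda>\<omega>. f (\<lambda>i. X i \<omega>)) \<in> borel_measurable M"
proof -
  have "(\<lambda>\<omega>. f (restrict (\<lambda>i. X i \<omega>) S)) \<in> borel_measurable M"
    using assms by (intro measurable_compose[OF measurable_restrict_ages]) (auto simp: local_fun_def)
  then show ?thesis
    using assms by (simp add: local_fun_def)
qed

lemma local_event_pred: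
  assumes "local_event S Q" "S \<subseteq> V"
  shows "Measurable.pred M (\<lambda>\<omega>. Q (\<lambda>i. X i \<omega>))"
proof -
  have "Measurable.pred M (\<lambda>\<omega>. Q (restrict (\<lambda>i. X i \<omega>) S))"
    using assms by (intro measurable_compose[OF measurable_restrict_ages]) (auto simp: local_event_def)
  then show ?thesis
    using assms by (simp add: local_event_def)
qed

lemma local_event_sets:
  assumes "local_event S Q" "S \<subseteq> V"
  shows "{\<omega> \<in> space M. Q (\<lambda>i. X i \<omega>)} \<in> sets M"
  using local_event_pred[OF assms] by simp

lemma integrable_local:
  assumes "local_fun S f" "S \<subseteq> V"
  shows "integrable M (\<lambda>\<omega>. f (\<lambda>i. X i \<omega>))"
proof -
  obtain B where "\<bar>f x\<bar> \<le> B" for x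
    using assms unfolding local_fun_def by blast
  then show ?thesis
    using local_fun_measurable[OF assms] by (intro integrable_const_bound[of _ B]) auto
qed

lemma mean_const [simp]: "mean (\<lambda>x. c) = c"
  by (simp add: mean_def prob_space)

lemma mean_cmult: "mean (\<lambda>x. c * f x) = c * mean f"
  by (simp add: mean_def)

lemma mean_add:
  "local_fun S f \<Longrightarrow> local_fun S g \<Longrightarrow> S \<subseteq> V \<Longrightarrow> mean (\<lambda>x. f x + g x) = mean f + mean g"
  unfolding mean_def by (intro Bochner_Integration.integral_add integrable_local[of S])

lemma mean_sum:
  "(\<And>j. j \<in> F \<Longrightarrow> local_fun S (f j)) \<Longrightarrow> S \<subseteq> V \<Longrightarrow>
   mean (\<lambda>x. \<Sum>j\<in>F. f j x) = (\<Sum>j\<in>F. mean (f j))"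
  unfolding mean_def by (intro Bochner_Integration.integral_sum integrable_local[of S])

lemma mean_sum_Sigma:
  assumes "\<And>i j. i \<in> A \<Longrightarrow> j \<in> B i \<Longrightarrow> local_fun S (f i j)" "S \<subseteq> V"
  shows "mean (\<lambda>x. \<Sum>i\<in>A. \<Sum>j\<in>B i. f i j x) = (\<Sum>i\<in>A. \<Sum>j\<in>B i. mean (f i j))"
proof -
  have "mean (\<lambda>x. \<Sum>i\<in>A. \<Sum>j\<in>B i. f i j x) = (\<Sum>i\<in>A. mean (\<lambda>x. \<Sum>j\<in>B i. f i j x))"
    using assms(1) by (intro mean_sum[OF local_fun_sum assms(2)])
  also have "\<dots> = (\<Sum>i\<in>A. \<Sum>j\<in>B i. mean (f i j))"
    using assms(1) by (intro sum.cong refl mean_sum[OF _ assms(2)])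
  finally show ?thesis .
qed

lemma mean_mono:
  "local_fun S f \<Longrightarrow> local_fun S g \<Longrightarrow> S \<subseteq> V \<Longrightarrow> (\<And>x. f x \<le> g x) \<Longrightarrow> mean f \<le> mean g"
  unfolding mean_def by (intro integral_mono integrable_local[of S])

lemma mean_of_bool: "local_event S Q \<Longrightarrow> S \<subseteq> V \<Longrightarrow> mean (\<lambda>x. of_bool (Q x)) = pr Q"
proof -
  assume Q: "local_event S Q" "S \<subseteq> V"
  have "mean (\<lambda>x. of_bool (Q x)) = (\<integral>\<omega>. indicator {\<omega> \<in> space M. Q (\<lambda>i. X i \<omega>)} \<omega> \<partial>M)"
    unfolding mean_def by (intro Bochner_Integration.integral_cong) (auto simp: indicator_def)
  then show ?thesis
    using local_event_sets[OF Q] by (simp add: pr_def)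
qed

text \<open>Restrictions of the ages to disjoint index sets are independent random vectors, and
  \<open>f\<close> and \<open>g\<close> are bounded functions of them.\<close>

lemma mean_mult:
  assumes "local_fun S f" "local_fun T g" "S \<inter> T = {}" "S \<subseteq> V" "T \<subseteq> V"
  shows "mean (\<lambda>x. f x * g x) = mean f * mean g"
proof -
  have "indep_var borel (f \<circ> (\<lambda>\<omega>. restrict (\<lambda>i. X i \<omega>) S)) borel (g \<circ> (\<lambda>\<omega>. restrict (\<lambda>i. X i \<omega>) T))"
    using assms
    by (intro indep_var_compose[OF indep_var_restrict[OF indep]]) (auto simp: local_fun_def)
  then have "indep_var borel (\<lambda>\<omega>. f (\<lambda>i. X i \<omega>)) borel (\<lambda>\<omega>. g (\<lambda>i. X i \<omega>))"
    using assms by (simp add: local_fun_def comp_def)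
  then show ?thesis
    unfolding mean_def using assms by (intro indep_var_lebesgue_integral integrable_local[of S f] integrable_local[of T g])
qed

lemma pr_conj:
  assumes "local_event S Q" "local_event T R" "S \<inter> T = {}" "S \<subseteq> V" "T \<subseteq> V"
  shows "pr (\<lambda>x. Q x \<and> R x) = pr Q * pr R"
proof -
  have "local_event (S \<union> T) (\<lambda>x. Q x \<and> R x)"
    using assms by (intro local_event_conj) (auto elim: local_event_mono)
  then have "pr (\<lambda>x. Q x \<and> R x) = mean (\<lambda>x. of_bool (Q x \<and> R x))"
    using assms by (intro mean_of_bool[of "S \<union> T", symmetric]) auto
  also have "\<dots> = mean (\<lambda>x. of_bool (Q x) * of_bool (R x))"
    by (simp add: of_bool_conj)
  also have "\<dots> = mean (\<lambda>x. of_bool (Q x)) * mean (\<lambda>x. of_bool (R x))"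
    using assms by (intro mean_mult[of S _ T] local_fun_of_bool)
  finally show ?thesis
    by (simp add: mean_of_bool[OF assms(1,4)] mean_of_bool[OF assms(2,5)])
qed

lemma pr_mono:
  "local_event S R \<Longrightarrow> S \<subseteq> V \<Longrightarrow> (\<And>x. Q x \<Longrightarrow> R x) \<Longrightarrow> pr Q \<le> pr R"
  unfolding pr_def by (intro finite_measure_mono local_event_sets[of S]) auto

lemma pr_nonneg [simp]: "0 \<le> pr Q"
  by (simp add: pr_def)

lemma pr_le_1 [simp]: "pr Q \<le> 1"
  by (simp add: pr_def)

lemma pr_True [simp]: "pr (\<lambda>x. True) = 1"
  by (simp add: pr_def prob_space)

lemma pr_not:
  assumes "local_event S Q" "S \<subseteq> V"
  shows "pr (\<lambda>x. \<not> Q x) = 1 - pr Q"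
proof -
  have "{\<omega> \<in> space M. \<not> Q (\<lambda>i. X i \<omega>)} = space M - {\<omega> \<in> space M. Q (\<lambda>i. X i \<omega>)}"
    by auto
  then show ?thesis
    unfolding pr_def using prob_compl[OF local_event_sets[OF assms]] by simp
qed

lemma pr_disj_le:
  assumes "local_event S Q" "local_event S R" "S \<subseteq> V"
  shows "pr (\<lambda>x. Q x \<or> R x) \<le> pr Q + pr R"
proof -
  have "{\<omega> \<in> space M. Q (\<lambda>i. X i \<omega>) \<or> R (\<lambda>i. X i \<omega>)}
      = {\<omega> \<in> space M. Q (\<lambda>i. X i \<omega>)} \<union> {\<omega> \<in> space M. R (\<lambda>i. X i \<omega>)}"
    by auto
  then show ?thesis
    unfolding pr_def using assms by (simp add: measure_Un_le local_event_sets)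
qed

lemma pr_disj:
  assumes "local_event S Q" "local_event S R" "S \<subseteq> V" "\<And>x. \<not> (Q x \<and> R x)"
  shows "pr (\<lambda>x. Q x \<or> R x) = pr Q + pr R"
proof -
  have "{\<omega> \<in> space M. Q (\<lambda>i. X i \<omega>) \<or> R (\<lambda>i. X i \<omega>)}
      = {\<omega> \<in> space M. Q (\<lambda>i. X i \<omega>)} \<union> {\<omega> \<in> space M. R (\<lambda>i. X i \<omega>)}"
    by auto
  moreover have "{\<omega> \<in> space M. Q (\<lambda>i. X i \<omega>)} \<inter> {\<omega> \<in> space M. R (\<lambda>i. X i \<omega>)} = {}"
    using assms(4) by blast
  ultimately show ?thesis
    unfolding pr_def using assms(1-3) by (simp add: finite_measure_Union local_event_sets)
qed

lemma pr_bex_le: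
  assumes "finite F" "\<And>j. j \<in> F \<Longrightarrow> local_event S (Q j)" "S \<subseteq> V"
  shows "pr (\<lambda>x. \<exists>j\<in>F. Q j x) \<le> (\<Sum>j\<in>F. pr (Q j))"
  using assms
proof (induction F rule: finite_induct)
  case (insert j F)
  have "pr (\<lambda>x. \<exists>k\<in>insert j F. Q k x) = pr (\<lambda>x. Q j x \<or> (\<exists>k\<in>F. Q k x))"
    by simp
  also have "\<dots> \<le> pr (Q j) + pr (\<lambda>x. \<exists>k\<in>F. Q k x)"
    using insert by (intro pr_disj_le[of S] local_event_intros) auto
  finally show ?case
    using insert by force
qed (simp add: pr_def)

lemma pr_bex:
  assumes "finite F" "\<And>j. j \<in> F \<Longrightarrow> local_event S (Q j)" "S \<subseteq> V"
    and "\<And>j k x. j \<in> F \<Longrightarrow> k \<in> F \<Longrightarrow> Q j x \<Longrightarrow> Q k x \<Longrightarrow> j = k"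
  shows "pr (\<lambda>x. \<exists>j\<in>F. Q j x) = (\<Sum>j\<in>F. pr (Q j))"
  using assms
proof (induction F rule: finite_induct)
  case (insert j F)
  have "pr (\<lambda>x. \<exists>k\<in>insert j F. Q k x) = pr (\<lambda>x. Q j x \<or> (\<exists>k\<in>F. Q k x))"
    by simp
  also have "\<dots> = pr (Q j) + pr (\<lambda>x. \<exists>k\<in>F. Q k x)"
  proof (intro pr_disj[of S] local_event_intros)
    show "\<not> (Q j x \<and> (\<exists>k\<in>F. Q k x))" for x
      using insert by blast
  qed (use insert in auto)
  finally show ?case
    using insert by auto
qed (simp add: pr_def)

text \<open>
  If \<open>Q\<close> prescribes the order of a rooted forest on \<open>S\<close> (parents younger), then \<open>k\<close> is the number
  of vertices and \<open>c\<close> the reciprocal of the product of the hook lengths; keeping track of the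
  threshold \<open>t\<close> allows adding a new root by a single integration.
\<close>

definition hook :: "'a set \<Rightarrow> (('a \<Rightarrow> real) \<Rightarrow> bool) \<Rightarrow> nat \<Rightarrow> real \<Rightarrow> bool" where
  "hook S Q k c \<longleftrightarrow> finite S \<and> S \<subseteq> V \<and> local_event S Q \<and>
     (\<forall>t\<in>{0..1}. pr (\<lambda>x. Q x \<and> (\<forall>j\<in>S. t < x j)) = c * (1 - t) ^ k)"

text \<open>Disjoint vertex sets carry independent ages and the threshold condition on the union
  splits, so the powers of \<open>1 - t\<close> multiply.\<close>

lemma hook_Un:
  assumes "hook S Q k c" "hook T R l d" "S \<inter> T = {}"
  shows "hook (S \<union> T) (\<lambda>x. Q x \<and> R x) (k + l) (c * d)"
proof -
  have fin: "finite S" "finite T" and sub: "S \<subseteq> V" "T \<subseteq> V"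
    and loc: "local_event S Q" "local_event T R"
    using assms by (auto simp: hook_def)
  have "pr (\<lambda>x. (Q x \<and> R x) \<and> (\<forall>j\<in>S \<union> T. t < x j)) = c * d * (1 - t) ^ (k + l)"
    if t: "t \<in> {0..1}" for t
  proof -
    have "pr (\<lambda>x. (Q x \<and> R x) \<and> (\<forall>j\<in>S \<union> T. t < x j))
        = pr (\<lambda>x. (Q x \<and> (\<forall>j\<in>S. t < x j)) \<and> (R x \<and> (\<forall>j\<in>T. t < x j)))"
      by (rule arg_cong[of _ _ pr]) auto
    also have "\<dots> = pr (\<lambda>x. Q x \<and> (\<forall>j\<in>S. t < x j)) * pr (\<lambda>x. R x \<and> (\<forall>j\<in>T. t < x j))"
      using fin sub loc assms(3) by (intro pr_conj[of S _ T] local_event_intros) auto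
    finally show ?thesis
      using assms t by (simp add: hook_def power_add)
  qed
  moreover have "local_event (S \<union> T) (\<lambda>x. Q x \<and> R x)"
    using loc by (intro local_event_conj) (auto elim: local_event_mono)
  ultimately show ?thesis
    using fin sub by (simp add: hook_def)
qed

lemma hook_empty: "hook {} (\<lambda>x. True) 0 1"
  by (simp add: hook_def local_event_const)

text \<open>Condition on the age \<open>s\<close> of the new root \<open>i\<close>: the forest on
  \<open>S\<close> must lie above \<open>s\<close>, which has probability
  \<open>c * (1 - s) ^ k\<close>. Integrating over \<open>s\<close> from \<open>t\<close> to
  \<open>1\<close> raises the exponent by one and divides by the hook length \<open>1 + k\<close> of
  \<open>i\<close>.\<close>

lemma hook_insert:
  assumes Q: "hook S Q k c" and i: "i \<in> V" "i \<notin> S"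
  shows "hook (insert i S) (\<lambda>x. (\<forall>j\<in>S. x i < x j) \<and> Q x) (Suc k) (c / (1 + real k))"
proof -
  have fin: "finite S" and sub: "S \<subseteq> V" and loc: "local_event S Q"
    using Q by (auto simp: hook_def)
  have c: "0 \<le> c"
    using Q pr_nonneg[of "\<lambda>x. Q x \<and> (\<forall>j\<in>S. 0 < x j)"] by (simp add: hook_def)
  have "pr (\<lambda>x. ((\<forall>j\<in>S. x i < x j) \<and> Q x) \<and> (\<forall>j\<in>insert i S. t < x j))
      = c / (1 + real k) * (1 - t) ^ Suc k" (is "?p = ?r")
    if t: "t \<in> {0..1}" for t
  proof -
    let ?P = "PiM S (\<lambda>_. borel :: real measure)"
    let ?I = "PiM {i} (\<lambda>_. borel :: real measure)"
    let ?Y = "\<lambda>\<omega>. restrict (\<lambda>i. X i \<omega>) S"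
    let ?Z = "\<lambda>\<omega>. restrict (\<lambda>i. X i \<omega>) {i}"
    \<comment> \<open>The independence statement speaks of the product over \<open>{i}\<close>,
      hence \<open>?A\<close>; \<open>?B\<close> is the same event with the age of \<open>i\<close>
      as a plain real number.\<close>
    let ?B = "{p \<in> space (borel \<Otimes>\<^sub>M ?P). t < fst p \<and> (\<forall>j\<in>S. fst p < snd p j) \<and> Q (snd p)}"
    let ?A = "{p \<in> space (?I \<Otimes>\<^sub>M ?P). t < fst p i \<and> (\<forall>j\<in>S. fst p i < snd p j) \<and> Q (snd p)}"
    have ind: "indep_var ?I ?Z ?P ?Y"
      using i sub by (intro indep_var_restrict[OF indep]) auto
    have meas [measurable]: "X i \<in> borel_measurable M" "?Y \<in> measurable M ?P" "?Z \<in> measurable M ?I"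
      using ind indep_var_rv1 indep_var_rv2 indep i unfolding indep_vars_def by blast+
    have [measurable]: "Measurable.pred ?P Q"
      using loc by (simp add: local_event_def)
    have Qr: "Q (restrict x S) = Q x" for x
      using loc by (simp add: local_event_def)
    have A: "?A \<in> sets (?I \<Otimes>\<^sub>M ?P)" and B: "?B \<in> sets (borel \<Otimes>\<^sub>M ?P)"
      using fin by measurable
    interpret Y: prob_space "distr M ?P ?Y"
      by (rule prob_space_distr) simp
    \<comment> \<open>\<open>h s\<close> is the conditional probability of the event given that
      \<open>i\<close> has age \<open>s\<close>.\<close>
    define h where "h s = emeasure (distr M ?P ?Y) (Pair s -` ?B)" for s
    have h [measurable]: "h \<in> borel_measurable borel"
      using Y.measurable_emeasure_Pair[of ?B borel] B unfolding h_def by simp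
    have slice: "h s = ennreal (c * (1 - s) ^ k * of_bool (t < s))"
      if s: "s \<in> {0..1}" for s
    proof -
      have "h s = emeasure M (?Y -` (Pair s -` ?B) \<inter> space M)"
        unfolding h_def using sets_Pair1[OF B] by (subst emeasure_distr) auto
      also have "\<dots> = emeasure M {\<omega> \<in> space M. t < s \<and> (\<forall>j\<in>S. s < X j \<omega>) \<and> Q (\<lambda>i. X i \<omega>)}"
        using measurable_space[OF meas(2)]
        by (intro arg_cong[of _ _ "emeasure M"]) (auto simp: Qr space_pair_measure)
      also have "\<dots> = (if t < s then ennreal (pr (\<lambda>x. Q x \<and> (\<forall>j\<in>S. s < x j))) else 0)"
        by (auto simp: pr_def emeasure_eq_measure conj_commute)
      finally show ?thesis
        using Q s by (simp add: hook_def)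
    qed
    have "ennreal ?p = emeasure M ((\<lambda>\<omega>. (?Z \<omega>, ?Y \<omega>)) -` ?A \<inter> space M)"
      unfolding pr_def emeasure_eq_measure[symmetric]
      using measurable_space[OF meas(2)] measurable_space[OF meas(3)]
      by (intro arg_cong[of _ _ "emeasure M"]) (auto simp: Qr space_pair_measure)
    also have "\<dots> = emeasure (distr M (?I \<Otimes>\<^sub>M ?P) (\<lambda>\<omega>. (?Z \<omega>, ?Y \<omega>))) ?A"
      using A by (subst emeasure_distr) auto
    also have "\<dots> = emeasure (distr M ?I ?Z \<Otimes>\<^sub>M distr M ?P ?Y) ?A"
      using ind by (simp add: indep_var_distribution_eq)
    also have "\<dots> = (\<integral>\<^sup>+z. emeasure (distr M ?P ?Y) (Pair z -` ?A) \<partial>distr M ?I ?Z)"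
      using A by (intro Y.emeasure_pair_measure_alt) simp
    also have "\<dots> = (\<integral>\<^sup>+z. h (z i) \<partial>distr M ?I ?Z)"
      unfolding h_def
      by (intro nn_integral_cong arg_cong[of _ _ "emeasure (distr M ?P ?Y)"])
        (auto simp: space_pair_measure)
    also have "\<dots> = (\<integral>\<^sup>+\<omega>. h (X i \<omega>) \<partial>M)"
      by (subst nn_integral_distr) auto
    also have "\<dots> = (\<integral>\<^sup>+s. h s \<partial>distr M borel (X i))"
      by (subst nn_integral_distr) auto
    also have "\<dots> = (\<integral>\<^sup>+s. h s \<partial>uniform_measure lborel {0..1})"
      using i by (simp add: uniform)
    also have "\<dots> = (\<integral>\<^sup>+s. h s * indicator {0..1} s \<partial>lborel)"
      by (subst nn_integral_uniform_measure) (auto simp: divide_ennreal_def)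
    also have "\<dots> = (\<integral>\<^sup>+s. ennreal (c * (1 - s) ^ k) * indicator {t..1} s \<partial>lborel)"
    proof (intro nn_integral_cong_AE)
      \<comment> \<open>\<open>slice\<close> asks for \<open>t < s\<close> while the interval is
        closed, so the integrands may differ at the null point \<open>t\<close>.\<close>
      have "AE s in lborel. s \<noteq> t"
        by (rule AE_lborel_singleton)
      then show "AE s in lborel. h s * indicator {0..1} s
          = ennreal (c * (1 - s) ^ k) * indicator {t..1} s"
      proof eventually_elim
        case (elim s)
        then show ?case
          using t slice[of s] by (auto simp: indicator_def)
      qed
    qed
    also have "\<dots> = ennreal (0 - (- (c / (1 + real k) * (1 - t) ^ Suc k)))"
    proof -
      have "(\<integral>\<^sup>+s. ennreal (c * (1 - s) ^ k) * indicator {t..1} s \<partial>lborel)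
        = ennreal ((\<lambda>s. - (c / (1 + real k) * (1 - s) ^ Suc k)) 1
            - (\<lambda>s. - (c / (1 + real k) * (1 - s) ^ Suc k)) t)"
      proof (rule nn_integral_FTC_Icc)
        fix s assume "s \<in> {t..1}"
        have "((\<lambda>s. - (c / (1 + real k) * (1 - s) ^ Suc k)) has_real_derivative
           - (c / (1 + real k) * (real (Suc k) * (1 - s) ^ k * (- 1)))) (at s)"
          by (rule derivative_eq_intros refl | simp)+
        also have "- (c / (1 + real k) * (real (Suc k) * (1 - s) ^ k * (- 1))) = c * (1 - s) ^ k"
          by (simp add: divide_simps)
        finally show "((\<lambda>s. - (c / (1 + real k) * (1 - s) ^ Suc k)) has_real_derivative
           c * (1 - s) ^ k) (at s)" .
      qed (use t c in auto)
      then show ?thesis by simp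
    qed
    finally have "ennreal ?p = ennreal ?r"
      by simp
    then show ?thesis
      using c t by (subst (asm) ennreal_inj) auto
  qed
  moreover have "local_event (insert i S) (\<lambda>x. (\<forall>j\<in>S. x i < x j) \<and> Q x)"
    using fin loc by (intro local_event_intros) (auto elim: local_event_mono)
  ultimately show ?thesis
    using fin sub i by (simp add: hook_def)
qed

text \<open>Take the threshold \<open>t = 0\<close>: all ages are almost surely positive, so the
  threshold condition costs nothing there.\<close>

lemma hook_pr:
  assumes "hook S Q k c"
  shows "pr Q = c"
proof -
  have fin: "finite S" and sub: "S \<subseteq> V" and loc: "local_event S Q"
    using assms by (auto simp: hook_def)
  have "AE \<omega> in M. 0 < X j \<omega>" if "j \<in> V" for j
  proof -
    have [measurable]: "X j \<in> borel_measurable M"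
      using indep that by (auto simp: indep_vars_def)
    have "AE s in uniform_measure lborel {0..1::real}. 0 < s"
      using AE_lborel_singleton[of 0] by (auto intro!: AE_uniform_measureI)
    then have "AE s in distr M borel (X j). 0 < s"
      unfolding uniform[OF that] .
    then show ?thesis
      by (subst (asm) AE_distr_iff) auto
  qed
  then have "AE \<omega> in M. \<forall>j\<in>S. 0 < X j \<omega>"
    using fin sub by (intro AE_finite_allI) auto
  then have "pr Q = pr (\<lambda>x. Q x \<and> (\<forall>j\<in>S. 0 < x j))"
    unfolding pr_def using fin sub loc
    by (intro finite_measure_eq_AE local_event_sets[of S] local_event_intros) auto
  also have "\<dots> = c"
    using assms by (simp add: hook_def)
  finally show ?thesis .
qed

text \<open>A forest without edges: each isolated root contributes the factor
  \<open>1\<close>.\<close>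

lemma hook_free:
  assumes "finite S" "S \<subseteq> V"
  shows "hook S (\<lambda>x. True) (card S) 1"
  using assms
proof (induction S rule: finite_induct)
  case (insert i S)
  have "hook {i} (\<lambda>x. True) 1 1"
    using hook_insert[OF hook_empty, of i] insert by simp
  from hook_Un[OF this, of S "\<lambda>x. True" "card S" 1] insert show ?case
    by simp
qed (simp add: hook_empty)

end

section \<open>Two adjacent vertices\<close>

text \<open>All inequalities are strict, so a tie makes it fail; each alternative is thereby an
  order event of the kind \<open>hook\<close> handles.\<close>

definition at_most_one_younger :: "'a \<Rightarrow> 'a set \<Rightarrow> ('a \<Rightarrow> real) \<Rightarrow> bool" where
  "at_most_one_younger i F x \<longleftrightarrow> (\<forall>j\<in>F. x i < x j) \<or> (\<exists>f\<in>F. x f < x i \<and> (\<forall>j\<in>F - {f}. x i < x j))"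

text \<open>In use \<open>v\<close> is the parent of \<open>u\<close>, \<open>F\<close> holds the
  other children of \<open>v\<close>, and \<open>H\<close> the children of \<open>u\<close> other
  than the next path vertex. That vertex and the parent of \<open>v\<close> do not occur, so their
  ages stay free. The three alternatives exclude one another.\<close>

definition block :: "'a \<Rightarrow> 'a \<Rightarrow> 'a set \<Rightarrow> 'a set \<Rightarrow> ('a \<Rightarrow> real) \<Rightarrow> bool" where
  "block v u F H x \<longleftrightarrow>
     (\<forall>j\<in>F. x v < x j) \<and> (\<forall>j\<in>H. x u < x j) \<or>
     (\<exists>f\<in>F. x f < x v \<and> (\<forall>j\<in>F - {f}. x v < x j) \<and> x v < x u \<and> (\<forall>j\<in>H. x u < x j)) \<or>
     (\<exists>h\<in>H. x h < x u \<and> (\<forall>j\<in>H - {h}. x u < x j) \<and> x u < x v \<and> (\<forall>j\<in>F. x v < x j))"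

lemma at_most_one_younger_mono:
  "at_most_one_younger i F x \<Longrightarrow> G \<subseteq> F \<Longrightarrow> at_most_one_younger i G x"
  unfolding at_most_one_younger_def by (metis Diff_iff insertCI singletonD subsetD)

lemma block_at_most_one_younger:
  assumes "block v u F H x"
  shows "at_most_one_younger v F x" "at_most_one_younger u H x"
  using assms unfolding block_def at_most_one_younger_def by blast+

lemma local_event_at_most_one_younger:
  "finite F \<Longrightarrow> local_event (insert i F) (at_most_one_younger i F)"
  unfolding at_most_one_younger_def by (intro local_event_intros) auto

lemma local_event_block:
  "finite F \<Longrightarrow> finite H \<Longrightarrow> local_event ({v, u} \<union> F \<union> H) (block v u F H)"
  unfolding block_def by (intro local_event_intros) auto

context uniform_ages
begin

lemma pr_youngest:
  assumes "finite F" "insert i F \<subseteq> V" "i \<notin> F"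
  shows "pr (\<lambda>x. \<forall>j\<in>F. x i < x j) = 1 / (1 + real (card F))"
  using hook_pr[OF hook_insert[OF hook_free]] assms by simp

text \<open>The order is a tree with root \<open>f\<close>, its only child \<open>i\<close>, and the
  rest of \<open>F\<close> as leaves below \<open>i\<close>. The hook lengths of \<open>f\<close>
  and \<open>i\<close> are \<open>1 + card F\<close> and \<open>card F\<close>.\<close>

lemma pr_second_youngest:
  assumes F: "finite F" "insert i F \<subseteq> V" "i \<notin> F" "f \<in> F"
  shows "pr (\<lambda>x. x f < x i \<and> (\<forall>j\<in>F - {f}. x i < x j)) = 1 / (real (card F) * (1 + real (card F)))"
proof -
  have card: "card F = Suc (card (F - {f}))"
    using F by (intro card.remove)
  have "hook (insert f (insert i (F - {f})))
      (\<lambda>x. (\<forall>j\<in>insert i (F - {f}). x f < x j) \<and> (\<forall>j\<in>F - {f}. x i < x j) \<and> True)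
      (Suc (Suc (card (F - {f}))))
      (1 / (1 + real (card (F - {f}))) / (1 + real (Suc (card (F - {f})))))"
    using F by (intro hook_insert hook_free) auto
  note hook_pr[OF this]
  also have "1 / (1 + real (card (F - {f}))) / (1 + real (Suc (card (F - {f}))))
      = 1 / (real (card F) * (1 + real (card F)))"
    unfolding card by simp
  \<comment> \<open>\<open>hook_insert\<close> also asks that \<open>f\<close> be younger than the
    rest of \<open>F\<close>, which follows by transitivity through \<open>i\<close>.\<close>
  also have "(\<lambda>x::'a \<Rightarrow> real. (\<forall>j\<in>insert i (F - {f}). x f < x j) \<and> (\<forall>j\<in>F - {f}. x i < x j) \<and> True)
      = (\<lambda>x. x f < x i \<and> (\<forall>j\<in>F - {f}. x i < x j))"
    by (auto simp: fun_eq_iff intro: less_trans)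
  finally show ?thesis .
qed

text \<open>Either \<open>i\<close> is the youngest in \<open>insert i F\<close> or the second
  youngest, and for nonempty \<open>F\<close> each of these ranks has probability
  \<open>1 / (1 + card F)\<close>. For empty \<open>F\<close> the bound exceeds
  \<open>1\<close>.\<close>

lemma pr_at_most_one_younger:
  assumes F: "finite F" "insert i F \<subseteq> V" "i \<notin> F"
  shows "pr (at_most_one_younger i F) \<le> 2 / (1 + real (card F))"
proof (cases "F = {}")
  case False
  have "pr (at_most_one_younger i F) \<le> pr (\<lambda>x. \<forall>j\<in>F. x i < x j)
      + pr (\<lambda>x. \<exists>f\<in>F. x f < x i \<and> (\<forall>j\<in>F - {f}. x i < x j))"
    unfolding at_most_one_younger_def using F
    by (intro pr_disj_le[of "insert i F"] local_event_intros) auto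
  also have "pr (\<lambda>x. \<exists>f\<in>F. x f < x i \<and> (\<forall>j\<in>F - {f}. x i < x j))
      \<le> (\<Sum>f\<in>F. pr (\<lambda>x. x f < x i \<and> (\<forall>j\<in>F - {f}. x i < x j)))"
    using F by (intro pr_bex_le[of _ "insert i F"] local_event_intros) auto
  also have "\<dots> = (\<Sum>f\<in>F. 1 / (real (card F) * (1 + real (card F))))"
    using F by (intro sum.cong refl pr_second_youngest) auto
  also have "\<dots> = 1 / (1 + real (card F))"
    using False F by simp
  finally show ?thesis
    using pr_youngest[OF F] by simp
next
  case True
  then show ?thesis
    using pr_le_1[of "at_most_one_younger i {}"] by (simp del: pr_le_1)
qed

text \<open>The order is a tree: \<open>f\<close> on top, \<open>v\<close> below it, and below
  \<open>v\<close> the leaves \<open>F - {f}\<close> together with \<open>u\<close>, which carries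
  the leaves \<open>H\<close>. The three factors are the hook lengths of \<open>u\<close>,
  \<open>v\<close> and \<open>f\<close>.\<close>

lemma pr_block_second:
  assumes F: "finite F" "finite H" "insert v (insert u (F \<union> H)) \<subseteq> V"
    "v \<notin> F" "v \<notin> H" "u \<notin> F" "u \<notin> H" "u \<noteq> v" "F \<inter> H = {}" "f \<in> F"
  shows "pr (\<lambda>x. x f < x v \<and> (\<forall>j\<in>F - {f}. x v < x j) \<and> x v < x u \<and> (\<forall>j\<in>H. x u < x j)) =
    1 / ((1 + real (card H)) * (1 + real (card F) + real (card H)) * (2 + real (card F) + real (card H)))"
proof -
  have card: "card F = Suc (card (F - {f}))"
    using F by (intro card.remove)
  let ?S = "insert u H \<union> (F - {f})"
  have "hook (insert f (insert v ?S))
      (\<lambda>x. (\<forall>j\<in>insert v ?S. x f < x j) \<and> (\<forall>j\<in>?S. x v < x j) \<and> ((\<forall>j\<in>H. x u < x j) \<and> True) \<and> True)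
      (Suc (Suc (Suc (card H) + card (F - {f}))))
      (1 / (1 + real (card H)) * 1 / (1 + real (Suc (card H) + card (F - {f})))
         / (1 + real (Suc (Suc (card H) + card (F - {f})))))"
    using F by (intro hook_insert hook_Un hook_free) auto
  note hook_pr[OF this]
  also have "1 / (1 + real (card H)) * 1 / (1 + real (Suc (card H) + card (F - {f})))
         / (1 + real (Suc (Suc (card H) + card (F - {f}))))
      = 1 / ((1 + real (card H)) * (1 + real (card F) + real (card H)) * (2 + real (card F) + real (card H)))"
    unfolding card by (simp add: add_ac)
  also have "(\<lambda>x::'a \<Rightarrow> real. (\<forall>j\<in>insert v ?S. x f < x j) \<and> (\<forall>j\<in>?S. x v < x j) \<and> ((\<forall>j\<in>H. x u < x j) \<and> True) \<and> True)
      = (\<lambda>x. x f < x v \<and> (\<forall>j\<in>F - {f}. x v < x j) \<and> x v < x u \<and> (\<forall>j\<in>H. x u < x j))"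
  proof (intro ext iffI)
    fix x :: "'a \<Rightarrow> real"
    assume "x f < x v \<and> (\<forall>j\<in>F - {f}. x v < x j) \<and> x v < x u \<and> (\<forall>j\<in>H. x u < x j)"
    then show "(\<forall>j\<in>insert v ?S. x f < x j) \<and> (\<forall>j\<in>?S. x v < x j) \<and> ((\<forall>j\<in>H. x u < x j) \<and> True) \<and> True"
      by (smt (verit) Un_iff insert_iff)
  qed auto
  finally show ?thesis .
qed

text \<open>The first alternative has the product probability; the other two, summed over the single
  younger child, add at least a third of it.\<close>

lemma pr_block_ge:
  assumes F: "finite F" "finite H" "insert v (insert u (F \<union> H)) \<subseteq> V"
    "v \<notin> F" "v \<notin> H" "u \<notin> F" "u \<notin> H" "u \<noteq> v" "F \<inter> H = {}" "F \<noteq> {}" "H \<noteq> {}"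
  shows "4 / 3 / ((1 + real (card F)) * (1 + real (card H))) \<le> pr (block v u F H)"
proof -
  let ?S = "{v, u} \<union> F \<union> H"
  let ?Q = "\<lambda>x. (\<forall>j\<in>F. x v < x j) \<and> (\<forall>j\<in>H. x u < x j)"
  let ?R = "\<lambda>v u F H f x. x f < x v \<and> (\<forall>j\<in>F - {f}. x v < x j) \<and> x v < x u \<and> (\<forall>j\<in>H. x u < x j)"
  define m n where "m = real (card F)" and "n = real (card H)"
  have mn: "1 \<le> m" "1 \<le> n"
    using F by (simp_all add: m_def n_def Suc_leI card_gt_0_iff)
  have "pr (block v u F H) = pr ?Q + pr (\<lambda>x. (\<exists>f\<in>F. ?R v u F H f x) \<or> (\<exists>h\<in>H. ?R u v H F h x))"
    unfolding block_def using F
    by (intro pr_disj[of ?S] local_event_intros) force+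
  also have "pr (\<lambda>x. (\<exists>f\<in>F. ?R v u F H f x) \<or> (\<exists>h\<in>H. ?R u v H F h x))
      = pr (\<lambda>x. \<exists>f\<in>F. ?R v u F H f x) + pr (\<lambda>x. \<exists>h\<in>H. ?R u v H F h x)"
    using F by (intro pr_disj[of ?S] local_event_intros) force+
  also have "pr (\<lambda>x. \<exists>f\<in>F. ?R v u F H f x) = (\<Sum>f\<in>F. pr (?R v u F H f))"
  proof (intro pr_bex[of _ ?S] local_event_intros)
    fix f g and x :: "'a \<Rightarrow> real" assume fg: "f \<in> F" "g \<in> F" "?R v u F H f x" "?R v u F H g x"
    show "f = g"
    proof (rule ccontr)
      assume "f \<noteq> g"
      then have "x v < x f"
        using fg by blast
      then show False
        using fg by simp
    qed
  qed (use F in auto)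
  also have "\<dots> = (\<Sum>f\<in>F. 1 / ((1 + n) * (1 + m + n) * (2 + m + n)))"
    unfolding m_def n_def using F by (intro sum.cong refl pr_block_second) auto
  also have "\<dots> = m / ((1 + n) * (1 + m + n) * (2 + m + n))"
    by (simp add: m_def)
  also have "pr (\<lambda>x. \<exists>h\<in>H. ?R u v H F h x) = (\<Sum>f\<in>H. pr (?R u v H F f))"
  proof (intro pr_bex[of _ ?S] local_event_intros)
    fix f g and x :: "'a \<Rightarrow> real" assume fg: "f \<in> H" "g \<in> H" "?R u v H F f x" "?R u v H F g x"
    show "f = g"
    proof (rule ccontr)
      assume "f \<noteq> g"
      then have "x u < x f"
        using fg by blast
      then show False
        using fg by simp
    qed
  qed (use F in auto)
  also have "\<dots> = (\<Sum>f\<in>H. 1 / ((1 + m) * (1 + n + m) * (2 + n + m)))"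
    unfolding m_def n_def using F by (intro sum.cong refl pr_block_second) auto
  also have "\<dots> = n / ((1 + m) * (1 + m + n) * (2 + m + n))"
    by (simp add: n_def add_ac)
  also have "pr ?Q = 1 / (1 + m) * (1 / (1 + n))"
  proof -
    have "pr ?Q = pr (\<lambda>x. \<forall>j\<in>F. x v < x j) * pr (\<lambda>x. \<forall>j\<in>H. x u < x j)"
      using F by (intro pr_conj[of "insert v F" _ "insert u H"] local_event_intros) auto
    then show ?thesis
      using F by (simp add: m_def n_def pr_youngest)
  qed
  finally have "pr (block v u F H) = (1 + (m * (m + 1) + n * (n + 1)) / ((1 + m + n) * (2 + m + n)))
      / ((1 + m) * (1 + n))"
    using mn by (simp add: divide_simps) algebra
  \<comment> \<open>Clearing denominators leaves \<open>1 \<le> (m - n)\<^sup>2 + m * n\<close>,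
    with equality at \<open>m = n = 1\<close>; this is the source of the constant
    \<open>4 / 3\<close>.\<close>
  moreover have "4 / 3 \<le> 1 + (m * (m + 1) + n * (n + 1)) / ((1 + m + n) * (2 + m + n))"
  proof -
    have "1 \<le> m * n"
      using mult_mono[of 1 m 1 n] mn by simp
    then have "1 \<le> (m - n)\<^sup>2 + m * n"
      using zero_le_power2[of "m - n"] by linarith
    then have "(1 + m + n) * (2 + m + n) \<le> 3 * (m * (m + 1) + n * (n + 1))"
      by (simp add: power2_eq_square algebra_simps)
    then show ?thesis
      using mn by (simp add: divide_simps)
  qed
  ultimately show ?thesis
    using mn unfolding m_def[symmetric] n_def[symmetric]
    by (simp only:) (intro divide_right_mono mult_nonneg_nonneg, auto)
qed

end

section \<open>The second-moment method\<close>

context uniform_ages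
begin

text \<open>Take expectations in the pointwise bound
  \<open>f \<le> f\<^sup>2 / (2 * B) + B / 2\<close> on the event \<open>0 < f\<close>: this gives
  \<open>1 \<le> 1 / 2 + B / 2 * pr (\<lambda>x. 0 < f x)\<close>.\<close>

lemma pr_pos_ge_inverse_second_moment:
  assumes f: "local_fun S f" "S \<subseteq> V" "\<And>x. 0 \<le> f x"
    and m: "mean f = 1" "mean (\<lambda>x. f x * f x) \<le> B" and B: "0 < B"
  shows "1 / B \<le> pr (\<lambda>x. 0 < f x)"
proof -
  have ev: "local_event S (\<lambda>x. 0 < f x)"
    using f by (intro local_event_pos)
  have "mean f \<le> mean (\<lambda>x. 1 / (2 * B) * (f x * f x) + B / 2 * of_bool (0 < f x))"
  proof (intro mean_mono[of S] local_fun_add local_fun_mult local_fun_const local_fun_of_bool ev f)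
    fix x
    have "f x * (2 * B) \<le> f x * f x + B * B"
      using zero_le_power2[of "f x - B"] by (simp add: power2_eq_square algebra_simps)
    then show "f x \<le> 1 / (2 * B) * (f x * f x) + B / 2 * of_bool (0 < f x)"
      using B f(3)[of x] by (cases "f x = 0") (auto simp: field_simps)
  qed
  also have "\<dots> = mean (\<lambda>x. 1 / (2 * B) * (f x * f x)) + mean (\<lambda>x. B / 2 * of_bool (0 < f x))"
    by (intro mean_add[of S] local_fun_mult local_fun_const local_fun_of_bool ev f)
  also have "\<dots> = 1 / (2 * B) * mean (\<lambda>x. f x * f x) + B / 2 * pr (\<lambda>x. 0 < f x)"
    using mean_of_bool[OF ev f(2)] by (simp only: mean_cmult)
  also have "\<dots> \<le> 1 / 2 + B / 2 * pr (\<lambda>x. 0 < f x)"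
    using m(2) B by (simp add: field_simps)
  finally show ?thesis
    using m(1) B by (simp add: field_simps)
qed

end

section \<open>Survival in a tree given by a parent function\<close>

locale parent_tree =
  fixes V :: "'a set" and \<rho> :: 'a and par :: "'a \<Rightarrow> 'a" and lev :: "'a \<Rightarrow> nat"
  assumes root: "\<rho> \<in> V" "lev \<rho> = 0"
    and par: "v \<in> V \<Longrightarrow> v \<noteq> \<rho> \<Longrightarrow> par v \<in> V"
    and lev_par: "v \<in> V \<Longrightarrow> v \<noteq> \<rho> \<Longrightarrow> lev v = Suc (lev (par v))"
begin

text \<open>\<open>par\<close> is unconstrained at the root, which is therefore excluded
  explicitly.\<close>

definition children :: "'a \<Rightarrow> 'a set" where
  "children v = {c \<in> V. c \<noteq> \<rho> \<and> par c = v}"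

text \<open>The levels determine how many parent steps lead from \<open>w\<close> up to
  \<open>v\<close>; fixing that number makes the disjointness of subtrees at equal levels
  immediate.\<close>

definition descendants :: "'a \<Rightarrow> 'a set" where
  "descendants v = {w \<in> V. lev v \<le> lev w \<and> (par ^^ (lev w - lev v)) w = v}"

lemma childrenD:
  assumes "c \<in> children v"
  shows "c \<in> V" "lev c = Suc (lev v)" "par c = v"
  using assms lev_par by (auto simp: children_def)

lemma descendants_subset: "descendants v \<subseteq> V"
  by (auto simp: descendants_def)

lemma self_descendants: "v \<in> V \<Longrightarrow> v \<in> descendants v"
  by (simp add: descendants_def)

lemma descendants_child:
  assumes "c \<in> children v"
  shows "descendants c \<subseteq> descendants v"
proof
  fix w assume w: "w \<in> descendants c"
  then have "lev w - lev v = Suc (lev w - lev c)"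
    using childrenD[OF assms] by (auto simp: descendants_def)
  then show "w \<in> descendants v"
    using w childrenD[OF assms] by (auto simp: descendants_def)
qed

lemma child_descendants: "c \<in> children v \<Longrightarrow> c \<in> descendants v"
  using descendants_child self_descendants childrenD(1) by blast

text \<open>By truncated subtraction the iterate of \<open>par\<close> is the identity here.\<close>

lemma descendants_low:
  assumes "y \<in> descendants w" "lev y \<le> lev w"
  shows "y = w"
proof -
  have "(par ^^ (lev y - lev w)) y = w"
    using assms(1) by (simp add: descendants_def)
  then show ?thesis
    using assms(2) by simp
qed

text \<open>A common element would have \<open>v\<close> and \<open>w\<close> as the same iterate of
  \<open>par\<close>.\<close>

lemma descendants_disjoint:
  "lev v = lev w \<Longrightarrow> v \<noteq> w \<Longrightarrow> descendants v \<inter> descendants w = {}"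
  unfolding descendants_def by force

end

section \<open>Surviving paths and their weights\<close>

locale aged_tree = parent_tree V \<rho> par lev + uniform_ages M V X
  for V :: "'a set" and \<rho> :: 'a and par :: "'a \<Rightarrow> 'a" and lev :: "'a \<Rightarrow> nat"
    and M :: "'b measure" and X :: "'a \<Rightarrow> 'b \<Rightarrow> real" +
  assumes finite_children: "v \<in> V \<Longrightarrow> finite (children v)"
    and two_children: "v \<in> V \<Longrightarrow> 2 \<le> card (children v)"
begin

definition step :: "'a \<Rightarrow> 'a \<Rightarrow> 'a \<Rightarrow> ('a \<Rightarrow> real) \<Rightarrow> bool" where
  "step v u w = block v u (children v - {u}) (children u - {w})"

text \<open>\<open>w\<close> and everything below it are left out: this is why a step is independent
  of what happens in the subtree of \<open>w\<close>.\<close>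

definition step_support :: "'a \<Rightarrow> 'a \<Rightarrow> 'a \<Rightarrow> 'a set" where
  "step_support v u w = {v, u} \<union> (children v - {u}) \<union> (children u - {w})"

definition br :: "'a \<Rightarrow> real" where
  "br v = real (card (children v))"

text \<open>
  The first two factors are the probability of the path under uniform random descent, so that
  \<open>weight\<close> below has mean \<open>1\<close>.
\<close>

definition coef :: "'a \<Rightarrow> 'a \<Rightarrow> 'a \<Rightarrow> real" where
  "coef v u w = 1 / (br v * br u * pr (step v u w))"

text \<open>\<open>n\<close> counts pairs of path vertices, so \<open>n\<close> steps descend
  \<open>2 * n\<close> levels; the vertex \<open>w\<close> that ends one step starts the next
  pair.\<close>

primrec survives :: "nat \<Rightarrow> 'a \<Rightarrow> ('a \<Rightarrow> real) \<Rightarrow> bool" where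
  "survives 0 v x \<longleftrightarrow> True"
| "survives (Suc n) v x \<longleftrightarrow> (\<exists>u\<in>children v. \<exists>w\<in>children u. step v u w x \<and> survives n w x)"

primrec weight :: "nat \<Rightarrow> 'a \<Rightarrow> ('a \<Rightarrow> real) \<Rightarrow> real" where
  "weight 0 v x = 1"
| "weight (Suc n) v x =
     (\<Sum>u\<in>children v. \<Sum>w\<in>children u. coef v u w * (of_bool (step v u w x) * weight n w x))"

abbreviation share :: "nat \<Rightarrow> 'a \<Rightarrow> 'a \<Rightarrow> 'a \<Rightarrow> ('a \<Rightarrow> real) \<Rightarrow> real" where
  "share n v u w x \<equiv> coef v u w * (of_bool (step v u w x) * weight n w x)"

lemma br_ge: "v \<in> V \<Longrightarrow> 2 \<le> br v"
  using two_children by (simp add: br_def)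

lemma local_event_step:
  "v \<in> V \<Longrightarrow> u \<in> children v \<Longrightarrow> local_event (step_support v u w) (step v u w)"
  unfolding step_def step_support_def
  using finite_children childrenD(1) by (intro local_event_block) auto

lemma step_support_subset:
  assumes "v \<in> V" "u \<in> children v" "w \<in> children u"
  shows "step_support v u w \<subseteq> descendants v"
  using assms self_descendants child_descendants descendants_child
  unfolding step_support_def by blast

text \<open>The support reaches down to the level of \<open>w\<close> at most and avoids
  \<open>w\<close>, whereas the only descendant of \<open>w\<close> on or above that level is
  \<open>w\<close> itself.\<close>

lemma step_support_disjoint:
  assumes "v \<in> V" "u \<in> children v" "w \<in> children u"
  shows "step_support v u w \<inter> descendants w = {}"
proof -
  have "lev y \<le> lev w \<and> y \<noteq> w" if "y \<in> step_support v u w" for y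
    using that childrenD(2)[OF assms(2)] childrenD(2)[OF assms(3)]
    by (auto simp: step_support_def dest: childrenD(2))
  then show ?thesis
    using descendants_low by blast
qed

text \<open>One child of each of \<open>v\<close> and \<open>u\<close> is on the path, so
  \<open>1 + card F\<close> and \<open>1 + card H\<close> in \<open>pr_block_ge\<close> become
  \<open>br v\<close> and \<open>br u\<close>. Having two children makes both sets nonempty.\<close>

lemma pr_step:
  assumes "v \<in> V" "u \<in> children v" "w \<in> children u"
  shows "4 / 3 / (br v * br u) \<le> pr (step v u w)" "0 < pr (step v u w)"
proof -
  note u = childrenD[OF assms(2)] and w = childrenD[OF assms(3)]
  have fin: "finite (children v)" "finite (children u)"
    using finite_children assms(1) u(1) by auto
  have two: "2 \<le> card (children v)" "2 \<le> card (children u)"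
    using two_children assms(1) u(1) by auto
  have card: "card (children v - {u}) = card (children v) - 1"
    "card (children u - {w}) = card (children u) - 1"
    using assms fin by (auto simp: card_Diff_singleton)
  then have ne: "children v - {u} \<noteq> {}" "children u - {w} \<noteq> {}"
    using two by (metis One_nat_def card.empty diff_is_0_eq not_less_eq_eq numeral_2_eq_2)+
  have br: "1 + real (card (children v - {u})) = br v" "1 + real (card (children u - {w})) = br u"
    unfolding card br_def using two by (simp_all add: of_nat_diff)
  have "4 / 3 / ((1 + real (card (children v - {u}))) * (1 + real (card (children u - {w}))))
      \<le> pr (step v u w)"
    unfolding step_def
  proof (rule pr_block_ge)
    show "insert v (insert u ((children v - {u}) \<union> (children u - {w}))) \<subseteq> V"
      using assms u by (auto dest: childrenD(1))
    show "v \<notin> children v - {u}" "v \<notin> children u - {w}" "u \<notin> children v - {u}"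
      "u \<notin> children u - {w}" "u \<noteq> v" "(children v - {u}) \<inter> (children u - {w}) = {}"
      using u(2) by (auto dest!: childrenD(2))
  qed (use fin ne in auto)
  then show *: "4 / 3 / (br v * br u) \<le> pr (step v u w)"
    unfolding br .
  have "0 < 4 / 3 / (br v * br u)"
    using br_ge[OF assms(1)] br_ge[OF u(1)] by simp
  then show "0 < pr (step v u w)"
    using * by linarith
qed

text \<open>The bound \<open>3 / 4\<close> is the reciprocal of the gain in \<open>pr_step\<close>
  and becomes the contraction factor of the second moment.\<close>

lemma coef:
  assumes "v \<in> V" "u \<in> children v" "w \<in> children u"
  shows "0 \<le> coef v u w" "coef v u w \<le> 3 / 4" "coef v u w * pr (step v u w) = 1 / (br v * br u)"
proof -
  have br: "0 < br v" "0 < br u"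
    using br_ge[OF assms(1)] br_ge[OF childrenD(1)[OF assms(2)]] by auto
  note p = pr_step[OF assms]
  show "0 \<le> coef v u w" "coef v u w * pr (step v u w) = 1 / (br v * br u)"
    using br p by (simp_all add: coef_def)
  show "coef v u w \<le> 3 / 4"
    using br p by (simp add: coef_def field_simps)
qed

lemma weight_nonneg: "v \<in> V \<Longrightarrow> 0 \<le> weight n v x"
proof (induction n arbitrary: v)
  case (Suc n)
  then show ?case
    using coef(1)[OF Suc.prems] by (auto intro!: sum_nonneg mult_nonneg_nonneg dest: childrenD(1))
qed simp

lemma weight_Suc: "weight (Suc n) v =
     (\<lambda>x. \<Sum>u\<in>children v. \<Sum>w\<in>children u. share n v u w x)"
  by (rule ext) simp

lemma survives_Suc: "survives (Suc n) v =
     (\<lambda>x. \<exists>u\<in>children v. \<exists>w\<in>children u. step v u w x \<and> survives n w x)"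
  by (rule ext) simp

lemma weight_0: "weight 0 v = (\<lambda>x. 1)"
  by (rule ext) simp

lemma survives_0: "survives 0 v = (\<lambda>x. True)"
  by (rule ext) simp

text \<open>A positive sum has a positive summand; its indicator and its remaining weight then both
  are positive.\<close>

lemma weight_pos_survives: "v \<in> V \<Longrightarrow> 0 < weight n v x \<Longrightarrow> survives n v x"
proof (induction n arbitrary: v)
  case (Suc n)
  from Suc.prems(2) obtain u where u: "u \<in> children v"
      "0 < (\<Sum>w\<in>children u. share n v u w x)"
    unfolding weight.simps by (meson not_less sum_nonpos)
  then obtain w where w: "w \<in> children u" "0 < share n v u w x"
    by (meson not_less sum_nonpos)
  then have "step v u w x" "weight n w x \<noteq> 0"
    by (cases "step v u w x", auto)+
  then have "0 < weight n w x"
    using weight_nonneg[OF childrenD(1)[OF w(1)], of n x] by simp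
  then have "survives n w x"
    by (intro Suc.IH childrenD(1)[OF w(1)])
  then show ?case
    using u(1) w(1) \<open>step v u w x\<close> by auto
qed simp

lemma local_fun_step_mult:
  assumes "v \<in> V" "u \<in> children v" "w \<in> children u" "local_fun (descendants w) f"
  shows "local_fun (descendants v) (\<lambda>x. c * (of_bool (step v u w x) * f x))"
proof (intro local_fun_mult local_fun_const)
  show "local_fun (descendants v) (\<lambda>x. of_bool (step v u w x))"
    using local_event_step[OF assms(1,2)] step_support_subset[OF assms(1-3)]
    by (intro local_fun_of_bool) (rule local_event_mono)
  show "local_fun (descendants v) f"
    using assms(2-4) descendants_child by (blast intro: local_fun_mono)
qed

lemma local_fun_weight: "v \<in> V \<Longrightarrow> local_fun (descendants v) (weight n v)"
proof (induction n arbitrary: v)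
  case (Suc n)
  show ?case
    unfolding weight_Suc
    using Suc.prems by (intro local_fun_sum local_fun_step_mult Suc.IH) (auto dest: childrenD(1))
qed (simp only: weight_0 local_fun_const)

lemma local_event_survives: "v \<in> V \<Longrightarrow> local_event (descendants v) (survives n v)"
proof (induction n arbitrary: v)
  case (Suc n)
  have "local_event (descendants v)
     (\<lambda>x. \<exists>u\<in>children v. \<exists>w\<in>children u. step v u w x \<and> survives n w x)"
  proof (intro local_event_bex local_event_conj finite_children Suc.prems)
    fix u w assume u: "u \<in> children v" and w: "w \<in> children u"
    show "local_event (descendants v) (step v u w)"
      using local_event_step[OF Suc.prems u] step_support_subset[OF Suc.prems u w]
      by (rule local_event_mono)
    show "local_event (descendants v) (survives n w)"
      using Suc.IH[OF childrenD(1)[OF w]] descendants_child u w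
      by (blast intro: local_event_mono)
  qed (auto dest: childrenD)
  then show ?case
    unfolding survives_Suc .
qed (simp only: survives_0 local_event_const)

lemma mean_step_mult:
  assumes "v \<in> V" "u \<in> children v" "w \<in> children u" "local_fun (descendants w) f"
  shows "mean (\<lambda>x. of_bool (step v u w x) * f x) = pr (step v u w) * mean f"
proof -
  have sub: "step_support v u w \<subseteq> V"
    using step_support_subset[OF assms(1-3)] descendants_subset by blast
  show ?thesis
    using mean_mult[OF local_fun_of_bool[OF local_event_step] assms(4) step_support_disjoint sub]
      assms(1-3) descendants_subset mean_of_bool[OF local_event_step sub] by simp
qed

text \<open>By independence and induction the pair \<open>u, w\<close> contributes
  \<open>1 / (br v * br u)\<close>, the probability of choosing it by uniform random
  descent.\<close>

lemma mean_weight: "v \<in> V \<Longrightarrow> mean (weight n v) = 1"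
proof (induction n arbitrary: v)
  case (Suc n)
  note v = Suc.prems
  let ?t = "\<lambda>u w x. share n v u w x"
  have loc: "local_fun (descendants v) (?t u w)" if "u \<in> children v" "w \<in> children u" for u w
    using v that by (intro local_fun_step_mult local_fun_weight) (auto dest: childrenD(1))
  have "mean (weight (Suc n) v) = (\<Sum>u\<in>children v. \<Sum>w\<in>children u. mean (?t u w))"
    unfolding weight_Suc by (rule mean_sum_Sigma[OF loc descendants_subset])
  also have "\<dots> = (\<Sum>u\<in>children v. \<Sum>w\<in>children u. 1 / (br v * br u))"
  proof (intro sum.cong refl)
    fix u w assume u: "u \<in> children v" and w: "w \<in> children u"
    have "mean (?t u w) = coef v u w * (pr (step v u w) * mean (weight n w))"
      using mean_step_mult[OF v u w local_fun_weight] childrenD(1)[OF w] by (simp only: mean_cmult)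
    also have "\<dots> = 1 / (br v * br u)"
      using coef(3)[OF v u w] Suc.IH[OF childrenD(1)[OF w]] by simp
    finally show "mean (?t u w) = 1 / (br v * br u)" .
  qed
  also have "\<dots> = (\<Sum>u\<in>children v. 1 / br v)"
  proof (intro sum.cong refl)
    fix u assume u: "u \<in> children v"
    show "(\<Sum>w\<in>children u. 1 / (br v * br u)) = 1 / br v"
      using br_ge[OF childrenD(1)[OF u]] by (simp add: br_def)
  qed
  also have "\<dots> = 1"
    using br_ge[OF v] by (simp add: br_def)
  finally show ?case .
qed (simp only: weight_0 mean_const)

end

section \<open>The recursion for the second moment\<close>

context aged_tree
begin

text \<open>The squared indicator is the indicator again. One of the two factors
  \<open>coef v u w\<close> cancels its probability, and the other is at most
  \<open>3 / 4\<close>.\<close>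

lemma mean_step_square_le:
  assumes "v \<in> V" "u \<in> children v" "w \<in> children u"
    and S: "mean (\<lambda>x. weight n w x * weight n w x) \<le> S"
  shows "mean (\<lambda>x. share n v u w x
       * share n v u w x) \<le> 3 / 4 * S / (br v * br u)"
proof -
  have w: "w \<in> V" and u: "u \<in> V"
    using childrenD(1) assms by auto
  let ?c = "coef v u w" and ?Z = "\<lambda>x. weight n w x * weight n w x"
  have "(\<lambda>x. (?c * (of_bool (step v u w x) * weight n w x)) * (?c * (of_bool (step v u w x) * weight n w x)))
      = (\<lambda>x. ?c * ?c * (of_bool (step v u w x) * ?Z x))"
    by (auto simp: fun_eq_iff)
  then have "mean (\<lambda>x. (?c * (of_bool (step v u w x) * weight n w x)) * (?c * (of_bool (step v u w x) * weight n w x)))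
      = ?c * ?c * mean (\<lambda>x. of_bool (step v u w x) * ?Z x)"
    by (simp only: mean_cmult)
  also have "\<dots> = ?c * (?c * pr (step v u w)) * mean ?Z"
    using mean_step_mult[OF assms(1-3) local_fun_mult[OF local_fun_weight[OF w] local_fun_weight[OF w]]]
    by simp
  also have "\<dots> = ?c * mean ?Z / (br v * br u)"
    unfolding coef(3)[OF assms(1-3)] by simp
  also have "\<dots> \<le> 3 / 4 * S / (br v * br u)"
  proof (intro divide_right_mono mult_mono coef(2)[OF assms(1-3)] S)
    show "0 \<le> mean ?Z"
      by (simp add: mean_def)
    show "0 \<le> br v * br u"
      by (simp add: br_def)
  qed simp
  finally show ?thesis .
qed

text \<open>
  The event \<open>D\<close> relaxes the two steps so as not to involve \<open>w\<close> and \<open>w'\<close>, whose ages influence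
  the weights below them.
\<close>

lemma mean_step_mult_le:
  assumes "v \<in> V" "u \<in> children v" "w \<in> children u" "u' \<in> children v" "w' \<in> children u'" "w \<noteq> w'"
    and D: "local_event S D" "S \<subseteq> V" "S \<inter> (descendants w \<union> descendants w') = {}"
    and imp: "\<And>x. step v u w x \<Longrightarrow> step v u' w' x \<Longrightarrow> D x"
  shows "mean (\<lambda>x. share n v u w x * share n v u' w' x) \<le> pr D"
proof -
  note c = coef[OF assms(1-3)] coef[OF assms(1,4,5)]
  have w: "w \<in> V" "w' \<in> V"
    using childrenD(1) assms by auto
  have lev: "lev w = lev w'"
    using assms(2-5) by (auto dest!: childrenD(2))
  note dis = descendants_disjoint[OF lev \<open>w \<noteq> w'\<close>]
  have loc: "local_fun (descendants w \<union> descendants w') (\<lambda>x. weight n w x * weight n w' x)"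
    using w by (intro local_fun_mult) (auto intro: local_fun_mono local_fun_weight)
  have loc1: "local_fun (descendants v) (\<lambda>x. share n v u w x)"
    "local_fun (descendants v) (\<lambda>x. share n v u' w' x)"
    using assms w by (auto intro!: local_fun_step_mult local_fun_weight)
  have "mean (\<lambda>x. share n v u w x * share n v u' w' x)
      \<le> mean (\<lambda>x. of_bool (D x) * (weight n w x * weight n w' x))"
  proof (rule mean_mono[of V])
    show "local_fun V (\<lambda>x. share n v u w x * share n v u' w' x)"
      by (rule local_fun_mono[OF local_fun_mult[OF loc1] descendants_subset])
    show "local_fun V (\<lambda>x. of_bool (D x) * (weight n w x * weight n w' x))"
      using descendants_subset
      by (intro local_fun_mult local_fun_mono[OF loc] local_fun_mono[OF local_fun_of_bool[OF D(1)] D(2)] Un_least)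
    show "share n v u w x
       * share n v u' w' x
       \<le> of_bool (D x) * (weight n w x * weight n w' x)" for x
    proof (cases "step v u w x \<and> step v u' w' x")
      case True
      \<comment> \<open>Both coefficients are at most \<open>1\<close>, so dropping them only
        increases the product.\<close>
      have "coef v u w * coef v u' w' * (weight n w x * weight n w' x) \<le> 1 * (weight n w x * weight n w' x)"
        using c mult_mono[of "coef v u w" 1 "coef v u' w'" 1] weight_nonneg[OF w(1), of n x] weight_nonneg[OF w(2), of n x]
        by (intro mult_right_mono) auto
      then show ?thesis
        using True imp[of x] by (simp add: mult_ac)
    next
      case False
      then show ?thesis
        using weight_nonneg[OF w(1), of n x] weight_nonneg[OF w(2), of n x] by auto
    qed
  qed simp
  \<comment> \<open>\<open>D\<close> ignores both subtrees, which are disjoint, so all three factors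
    are independent; each weight has mean \<open>1\<close>.\<close>
  also have "\<dots> = pr D * (mean (weight n w) * mean (weight n w'))"
    using mean_mult[OF local_fun_of_bool[OF D(1)] loc D(3) D(2)] descendants_subset
      mean_mult[OF local_fun_weight[OF w(1)] local_fun_weight[OF w(2)] dis descendants_subset descendants_subset]
      mean_of_bool[OF D(1,2)] by simp
  finally show ?thesis
    using mean_weight w by simp
qed

text \<open>At least \<open>br v - k\<close> children remain when at most \<open>k\<close> of them
  are hidden because they lie on the paths considered.\<close>

lemma pr_at_most_one_younger_children:
  assumes "v \<in> V" "F \<subseteq> children v" "card F \<le> k" "k < card (children v)"
  shows "pr (at_most_one_younger v (children v - F)) \<le> 2 / (br v + 1 - real k)"
proof -
  have fin: "finite (children v)" "finite F"
    using assms finite_children by (auto intro: finite_subset)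
  have "card (children v - F) = card (children v) - card F"
    using fin assms by (intro card_Diff_subset)
  then have *: "br v + 1 - real k \<le> 1 + real (card (children v - F))"
    using assms(3,4) by (simp add: br_def of_nat_diff)
  have "pr (at_most_one_younger v (children v - F)) \<le> 2 / (1 + real (card (children v - F)))"
    using fin assms(1) by (intro pr_at_most_one_younger) (auto dest: childrenD)
  also have "\<dots> \<le> 2 / (br v + 1 - real k)"
    using * assms(4) by (intro divide_left_mono mult_pos_pos) (auto simp: br_def)
  finally show ?thesis .
qed

lemma step_at_most_one_younger:
  assumes "step v u w x"
  shows "at_most_one_younger v (children v - {u}) x" "at_most_one_younger u (children u - {w}) x"
  using assms unfolding step_def by (auto dest: block_at_most_one_younger)

text \<open>The two paths share \<open>u\<close> and part there. With \<open>w\<close> and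
  \<open>w'\<close> both hidden from \<open>u\<close>, the conditions at \<open>v\<close> and at
  \<open>u\<close> use disjoint sets of ages. Hiding the second child costs at most a factor
  \<open>2\<close> in the bound at \<open>u\<close>.\<close>

lemma mean_siblings_le:
  assumes "v \<in> V" "u \<in> children v" "w \<in> children u" "w' \<in> children u" "w \<noteq> w'"
  shows "mean (\<lambda>x. share n v u w x * share n v u w' x) \<le> 8 / (br v * br u)"
proof -
  have u: "u \<in> V"
    using childrenD(1) assms by auto
  let ?A = "insert v (children v - {u})" and ?B = "insert u (children u - {w, w'})"
  let ?P = "at_most_one_younger v (children v - {u})" and ?Q = "at_most_one_younger u (children u - {w, w'})"
  have loc: "local_event ?A ?P" "local_event ?B ?Q"
    using finite_children assms(1) u by (auto intro!: local_event_at_most_one_younger)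
  have sub: "?A \<subseteq> V" "?B \<subseteq> V"
    using assms(1) u by (auto dest: childrenD(1))
  have "y \<notin> descendants w" "y \<notin> descendants w'" if "y \<in> ?A \<union> ?B" for y
  proof -
    have "lev y \<le> lev w" "lev y \<le> lev w'" "y \<noteq> w" "y \<noteq> w'"
      using that childrenD(2)[OF assms(2)] childrenD(2)[OF assms(3)] childrenD(2)[OF assms(4)]
      by (auto dest!: childrenD(2))
    then show "y \<notin> descendants w" "y \<notin> descendants w'"
      using descendants_low by blast+
  qed
  then have dis: "(?A \<union> ?B) \<inter> (descendants w \<union> descendants w') = {}"
    by blast
  have ev: "local_event (?A \<union> ?B) (\<lambda>x. ?P x \<and> ?Q x)"
    by (intro local_event_conj local_event_mono[OF loc(1)] local_event_mono[OF loc(2)]) blast+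
  have "mean (\<lambda>x. share n v u w x * share n v u w' x) \<le> pr (\<lambda>x. ?P x \<and> ?Q x)"
  proof (rule mean_step_mult_le[OF assms(1-3) assms(2,4,5) ev _ dis])
    show "?A \<union> ?B \<subseteq> V"
      using sub by simp
    show "?P x \<and> ?Q x" if "step v u w x" for x
      using step_at_most_one_younger[OF that] by (blast intro: at_most_one_younger_mono)
  qed
  also have "\<dots> = pr ?P * pr ?Q"
  proof (rule pr_conj[OF loc _ sub])
    show "?A \<inter> ?B = {}"
      using childrenD(2)[OF assms(2)] by (auto dest!: childrenD(2))
  qed
  also have "\<dots> \<le> 2 / br v * (4 / br u)"
  proof (intro mult_mono)
    show "pr ?P \<le> 2 / br v"
      using pr_at_most_one_younger_children[of v "{u}" 1] assms two_children[OF assms(1)] by simp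
    show "pr ?Q \<le> 4 / br u"
    proof (cases "br u = 2")
      \<comment> \<open>Here \<open>u\<close> has no children besides \<open>w\<close> and
        \<open>w'\<close>, and the claim reads \<open>pr ?Q \<le> 2\<close>.\<close>
      case True
      then show ?thesis
        using pr_le_1[of ?Q] by (simp del: pr_le_1)
    next
      case False
      then have "pr ?Q \<le> 2 / (br u - 1)"
        using pr_at_most_one_younger_children[of u "{w, w'}" 2] assms two_children[OF u] u
        by (auto simp: br_def)
      also have "\<dots> \<le> 4 / br u"
        using br_ge[OF u] by (simp add: field_simps)
      finally show ?thesis .
    qed
  qed (use br_ge[OF assms(1)] in auto)
  finally show ?thesis
    by simp
qed

text \<open>The paths part already at \<open>v\<close>. Three independent conditions remain: at
  \<open>v\<close> with \<open>u\<close> and \<open>u'\<close> hidden, at \<open>u\<close> without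
  \<open>w\<close>, and at \<open>u'\<close> without \<open>w'\<close>. They contribute
  \<open>4 / br v\<close>, \<open>2 / br u\<close> and \<open>2 / br u'\<close>.\<close>

lemma mean_cousins_le:
  assumes "v \<in> V" "u \<in> children v" "w \<in> children u" "u' \<in> children v" "w' \<in> children u'" "u \<noteq> u'"
  shows "mean (\<lambda>x. share n v u w x * share n v u' w' x) \<le> 16 / (br v * br u * br u')"
proof -
  have u: "u \<in> V" "u' \<in> V"
    using childrenD(1) assms by auto
  have ww': "w \<noteq> w'"
    using assms childrenD(3) by metis
  let ?A = "insert v (children v - {u, u'})" and ?B = "insert u (children u - {w})"
    and ?C = "insert u' (children u' - {w'})"
  let ?P = "at_most_one_younger v (children v - {u, u'})" and ?Q = "at_most_one_younger u (children u - {w})"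
    and ?R = "at_most_one_younger u' (children u' - {w'})"
  have loc: "local_event ?A ?P" "local_event ?B ?Q" "local_event ?C ?R"
    using finite_children assms(1) u by (auto intro!: local_event_at_most_one_younger)
  have sub: "?A \<subseteq> V" "?B \<subseteq> V" "?C \<subseteq> V"
    using assms(1) u by (auto dest: childrenD(1))
  have ch: "children u \<inter> children u' = {}"
    using assms(6) childrenD(3) by blast
  note lev = childrenD(2)[OF assms(2)] childrenD(2)[OF assms(3)] childrenD(2)[OF assms(4)] childrenD(2)[OF assms(5)]
  have "y \<notin> descendants w" "y \<notin> descendants w'" if "y \<in> ?A \<union> (?B \<union> ?C)" for y
  proof -
    have "lev y \<le> lev w" "lev y \<le> lev w'" "y \<noteq> w" "y \<noteq> w'"
      using that lev ch assms by (auto dest: childrenD(2))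
    then show "y \<notin> descendants w" "y \<notin> descendants w'"
      using descendants_low by blast+
  qed
  then have dis: "(?A \<union> (?B \<union> ?C)) \<inter> (descendants w \<union> descendants w') = {}"
    by blast
  have ev: "local_event (?A \<union> (?B \<union> ?C)) (\<lambda>x. ?P x \<and> (?Q x \<and> ?R x))"
    by (intro local_event_conj local_event_mono[OF loc(1)] local_event_mono[OF loc(2)]
        local_event_mono[OF loc(3)]) blast+
  have "mean (\<lambda>x. share n v u w x * share n v u' w' x) \<le> pr (\<lambda>x. ?P x \<and> (?Q x \<and> ?R x))"
  proof (rule mean_step_mult_le[OF assms(1-5) ww' ev _ dis])
    show "?A \<union> (?B \<union> ?C) \<subseteq> V"
      using sub by simp
    show "?P x \<and> (?Q x \<and> ?R x)" if "step v u w x" "step v u' w' x" for x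
      using step_at_most_one_younger[OF that(1)] step_at_most_one_younger[OF that(2)]
      by (blast intro: at_most_one_younger_mono)
  qed
  also have "\<dots> = pr ?P * (pr ?Q * pr ?R)"
  proof -
    have BC: "?B \<inter> ?C = {}"
      using lev ch assms(6) by (auto dest: childrenD(2))
    have ABC: "?A \<inter> (?B \<union> ?C) = {}"
    proof -
      have "lev y \<le> Suc (lev v) \<and> y \<noteq> u \<and> y \<noteq> u'" if "y \<in> ?A" for y
        using that lev by (auto dest: childrenD(2))
      moreover have "y = u \<or> y = u' \<or> lev y = Suc (Suc (lev v))" if "y \<in> ?B \<union> ?C" for y
        using that lev(1,3) childrenD(2)[of y u] childrenD(2)[of y u'] by auto
      ultimately show ?thesis
        by fastforce
    qed
    have "local_event (?B \<union> ?C) (\<lambda>x. ?Q x \<and> ?R x)"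
      by (intro local_event_conj local_event_mono[OF loc(2)] local_event_mono[OF loc(3)]) auto
    then have "pr (\<lambda>x. ?P x \<and> (?Q x \<and> ?R x)) = pr ?P * pr (\<lambda>x. ?Q x \<and> ?R x)"
      using sub by (intro pr_conj[OF loc(1) _ ABC]) auto
    then show ?thesis
      using pr_conj[OF loc(2,3) BC sub(2,3)] by simp
  qed
  also have "\<dots> \<le> 4 / br v * (2 / br u * (2 / br u'))"
  proof (intro mult_mono)
    show "pr ?Q \<le> 2 / br u" "pr ?R \<le> 2 / br u'"
      using pr_at_most_one_younger_children[of u "{w}" 1] pr_at_most_one_younger_children[of u' "{w'}" 1]
        assms u two_children[OF u(1)] two_children[OF u(2)] by simp_all
    show "pr ?P \<le> 4 / br v"
    proof (cases "br v = 2")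
      case True
      then show ?thesis
        using pr_le_1[of ?P] by (simp del: pr_le_1)
    next
      case False
      then have "pr ?P \<le> 2 / (br v - 1)"
        using pr_at_most_one_younger_children[of v "{u, u'}" 2] assms two_children[OF assms(1)]
        by (auto simp: br_def)
      also have "\<dots> \<le> 4 / br v"
        using br_ge[OF assms(1)] by (simp add: field_simps)
      finally show ?thesis .
    qed
  qed (use br_ge[OF assms(1)] br_ge[OF u(1)] br_ge[OF u(2)] in auto)
  finally show ?thesis
    by (simp add: mult_ac)
qed

lemma sum_children_const: "v \<in> V \<Longrightarrow> (\<Sum>u\<in>children v. c / br v) = c"
  using br_ge[of v] by (simp add: br_def)

text \<open>Expand the square into pairs of paths. Identical pairs sum to \<open>3 / 4 * S\<close>,
  pairs parting at a common \<open>u\<close> to the average of \<open>8 * br u\<close> over the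
  children, and pairs parting at \<open>v\<close> to \<open>16 * br v\<close>.\<close>

lemma second_moment_Suc:
  assumes v: "v \<in> V"
    and S: "\<And>u w. u \<in> children v \<Longrightarrow> w \<in> children u \<Longrightarrow> mean (\<lambda>x. weight n w x * weight n w x) \<le> S"
    and B: "\<And>u. u \<in> children v \<Longrightarrow> br u \<le> B"
  shows "mean (\<lambda>x. weight (Suc n) v x * weight (Suc n) v x) \<le> 3 / 4 * S + 8 * B + 16 * br v"
proof -
  let ?t = "\<lambda>u w x. share n v u w x"
  \<comment> \<open>A single formula covering the three cases: the sibling term is also counted for
    equal paths and the cousin term for all pairs, which only enlarges the bound.\<close>
  let ?b = "\<lambda>u w u' w'. of_bool (u' = u \<and> w' = w) * (3 / 4 * S / (br v * br u))
      + of_bool (u' = u) * (8 / (br v * br u)) + 16 / (br v * br u * br u')"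
  have Vu: "u \<in> V" if "u \<in> children v" for u
    using childrenD(1) that .
  have fin: "finite (children u)" if "u = v \<or> u \<in> children v" for u
    using that v finite_children Vu by blast
  have br: "0 < br u" if "u = v \<or> u \<in> children v" for u
    using that v Vu br_ge by force
  have loc: "local_fun (descendants v) (?t u w)" if "u \<in> children v" "w \<in> children u" for u w
    using v that by (intro local_fun_step_mult local_fun_weight) (auto dest: childrenD(1))
  have loc2: "local_fun (descendants v) (\<lambda>x. ?t u w x * ?t u' w' x)"
    if "u \<in> children v" "w \<in> children u" "u' \<in> children v" "w' \<in> children u'" for u w u' w'
    using that by (intro local_fun_mult[OF loc loc])
  have bound: "mean (\<lambda>x. ?t u w x * ?t u' w' x) \<le> ?b u w u' w'"
    if uw: "u \<in> children v" "w \<in> children u" "u' \<in> children v" "w' \<in> children u'" for u w u' w'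
  proof -
    note pos = br[of v] br[of u] br[of u']
    consider "u = u'" "w = w'" | "u = u'" "w \<noteq> w'" | "u \<noteq> u'"
      by blast
    then show ?thesis
    proof cases
      case 1
      have "mean (\<lambda>x. ?t u w x * ?t u w x) \<le> 3 / 4 * S / (br v * br u)"
        using mean_step_square_le[OF v uw(1,2) S[OF uw(1,2)]] .
      then show ?thesis
        using pos uw 1 by (simp add: add_increasing2)
    next
      case 2
      have "mean (\<lambda>x. ?t u w x * ?t u w' x) \<le> 8 / (br v * br u)"
        using mean_siblings_le[OF v uw(1,2), of w' n] uw 2 by auto
      then show ?thesis
        using pos uw 2 by (simp add: add_increasing2)
    next
      case 3
      have "mean (\<lambda>x. ?t u w x * ?t u' w' x) \<le> 16 / (br v * br u * br u')"
        using mean_cousins_le[OF v uw 3] .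
      then show ?thesis
        using 3 by simp
    qed
  qed
  have square: "(\<lambda>x. weight (Suc n) v x * weight (Suc n) v x)
      = (\<lambda>x. \<Sum>u\<in>children v. \<Sum>w\<in>children u. \<Sum>u'\<in>children v. \<Sum>w'\<in>children u'. ?t u w x * ?t u' w' x)"
    unfolding weight_Suc by (simp only: sum_distrib_right, simp only: sum_distrib_left)
  have "mean (\<lambda>x. weight (Suc n) v x * weight (Suc n) v x)
      = (\<Sum>u\<in>children v. \<Sum>w\<in>children u. mean (\<lambda>x. \<Sum>u'\<in>children v. \<Sum>w'\<in>children u'. ?t u w x * ?t u' w' x))"
    unfolding square by (rule mean_sum_Sigma[OF local_fun_sum[OF local_fun_sum[OF loc2]] descendants_subset])
  also have "\<dots> = (\<Sum>u\<in>children v. \<Sum>w\<in>children u. \<Sum>u'\<in>children v. \<Sum>w'\<in>children u'.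
      mean (\<lambda>x. ?t u w x * ?t u' w' x))"
    by (intro sum.cong refl mean_sum_Sigma[OF loc2 descendants_subset])
  also have "\<dots> \<le> (\<Sum>u\<in>children v. \<Sum>w\<in>children u. \<Sum>u'\<in>children v. \<Sum>w'\<in>children u'. ?b u w u' w')"
    by (intro sum_mono bound)
  also have "\<dots> \<le> (\<Sum>u\<in>children v. \<Sum>w\<in>children u. (3 / 4 * S + 8 * B + 16 * br v) / br v / br u)"
  proof (intro sum_mono)
    fix u w assume u: "u \<in> children v" and w: "w \<in> children u"
    have "(\<Sum>u'\<in>children v. \<Sum>w'\<in>children u'. ?b u w u' w')
        = (\<Sum>u'\<in>children v. of_bool (u' = u) * (3 / 4 * S / (br v * br u) + 8 / br v) + 16 / (br v * br u))"
    proof (intro sum.cong refl)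
      fix u' assume u': "u' \<in> children v"
      have "(\<Sum>w'\<in>children u'. of_bool (u' = u \<and> w' = w) * (3 / 4 * S / (br v * br u)))
          = of_bool (u' = u) * (3 / 4 * S / (br v * br u))"
      proof (cases "u' = u")
        case True
        then have "(\<Sum>w'\<in>children u'. of_bool (u' = u \<and> w' = w) * (3 / 4 * S / (br v * br u)))
            = (\<Sum>w'\<in>children u. if w' = w then 3 / 4 * S / (br v * br u) else 0)"
          by (intro sum.cong) auto
        then show ?thesis
          using True w fin[of u] u by (simp only: sum.delta) simp
      qed simp
      moreover have "(\<Sum>w'\<in>children u'. of_bool (u' = u) * (8 / (br v * br u))) = of_bool (u' = u) * (8 / br v)"
        using br[of u] u by (cases "u' = u") (simp_all add: br_def)
      moreover have "(\<Sum>w'\<in>children u'. 16 / (br v * br u * br u')) = 16 / (br v * br u)"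
        using br[of u'] u' by (simp add: br_def)
      ultimately show "(\<Sum>w'\<in>children u'. ?b u w u' w')
          = of_bool (u' = u) * (3 / 4 * S / (br v * br u) + 8 / br v) + 16 / (br v * br u)"
        by (simp only: sum.distrib distrib_left)
    qed
    also have "\<dots> = 3 / 4 * S / (br v * br u) + 8 / br v + 16 / br u"
      using u fin[of v] br[of v]
      by (auto simp: sum.distrib of_bool_def if_distrib[of "\<lambda>c. c * _"] sum.delta br_def cong: if_cong)
    \<comment> \<open>Here \<open>8 / br v\<close> becomes \<open>8 * B / (br v * br u)\<close>, so
      that the bound has the form of a constant times the descent probability of \<open>u, w\<close>
      and averages out.\<close>
    also have "\<dots> \<le> (3 / 4 * S + 8 * B + 16 * br v) / br v / br u"
      using B[OF u] br[of v] br[of u] u by (simp add: field_simps)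
    finally show "(\<Sum>u'\<in>children v. \<Sum>w'\<in>children u'. ?b u w u' w')
        \<le> (3 / 4 * S + 8 * B + 16 * br v) / br v / br u" .
  qed
  also have "\<dots> = 3 / 4 * S + 8 * B + 16 * br v"
    using v Vu by (simp only: sum_children_const cong: sum.cong)
  finally show ?thesis .
qed

text \<open>Induction with a bound uniform in \<open>n\<close>: \<open>w\<close> lies two levels
  below \<open>v\<close>, so one step turns \<open>G\<close> into
  \<open>3 / 4 * a\<^sup>2 * G\<close> plus \<open>24 * C * a\<close>, which the condition on
  \<open>G\<close> keeps below \<open>G\<close>. The \<open>24\<close> is \<open>8 + 16\<close>,
  after bounding \<open>br v\<close> by \<open>C * a\<close> times the power of \<open>a\<close> at
  its own level.\<close>

lemma second_moment_le:
  assumes a: "0 < C" "1 \<le> a" "3 / 4 * a\<^sup>2 < 1"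
    and growth: "\<And>v. v \<in> V \<Longrightarrow> br v \<le> C * a ^ lev v"
    and G: "1 \<le> G" "24 * C * a \<le> G * (1 - 3 / 4 * a\<^sup>2)"
    and v: "v \<in> V"
  shows "mean (\<lambda>x. weight n v x * weight n v x) \<le> G * a ^ lev v"
  using v
proof (induction n arbitrary: v)
  case 0
  have "1 * 1 \<le> G * a ^ lev v"
    using a G by (intro mult_mono) (auto simp: one_le_power)
  then show ?case
    by simp
next
  case (Suc n)
  let ?r = "a ^ lev v"
  have r: "0 < ?r"
    using a by simp
  have "mean (\<lambda>x. weight (Suc n) v x * weight (Suc n) v x)
      \<le> 3 / 4 * (G * (a\<^sup>2 * ?r)) + 8 * (C * (a * ?r)) + 16 * br v"
  proof (rule second_moment_Suc[OF Suc.prems])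
    fix u assume u: "u \<in> children v"
    then show "br u \<le> C * (a * ?r)"
      using growth[OF childrenD(1)[OF u]] childrenD(2)[OF u] by simp
    fix w assume w: "w \<in> children u"
    show "mean (\<lambda>x. weight n w x * weight n w x) \<le> G * (a\<^sup>2 * ?r)"
      using Suc.IH[OF childrenD(1)[OF w]] childrenD(2)[OF w] childrenD(2)[OF u]
      by (simp add: power2_eq_square mult_ac)
  qed
  also have "\<dots> \<le> 3 / 4 * (G * (a\<^sup>2 * ?r)) + 8 * (C * (a * ?r)) + 16 * (C * (a * ?r))"
  proof -
    have "br v \<le> C * ?r"
      using growth[OF Suc.prems] .
    also have "\<dots> \<le> C * (a * ?r)"
      using a r by simp
    finally show ?thesis
      by simp
  qed
  also have "\<dots> = (3 / 4 * G * a\<^sup>2 + 24 * C * a) * ?r"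
    by (simp add: algebra_simps)
  also have "\<dots> \<le> G * ?r"
    using G(2) r by (intro mult_right_mono) (auto simp: algebra_simps)
  finally show ?case .
qed

text \<open>The second-moment method applied to \<open>weight n v\<close>. The bound does not depend
  on \<open>n\<close>, which permits the passage to infinite survival.\<close>

lemma pr_survives_ge:
  assumes "0 < C" "1 \<le> a" "3 / 4 * a\<^sup>2 < 1"
    and "\<And>v. v \<in> V \<Longrightarrow> br v \<le> C * a ^ lev v"
    and "1 \<le> G" "24 * C * a \<le> G * (1 - 3 / 4 * a\<^sup>2)"
    and "v \<in> V"
  shows "1 / (G * a ^ lev v) \<le> pr (survives n v)"
proof -
  have "0 < G * a ^ lev v"
    using assms by simp
  then have "1 / (G * a ^ lev v) \<le> pr (\<lambda>x. 0 < weight n v x)"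
    using assms mean_weight weight_nonneg second_moment_le[OF assms]
    by (intro pr_pos_ge_inverse_second_moment[OF local_fun_weight descendants_subset]) auto
  also have "\<dots> \<le> pr (survives n v)"
    using assms(7) weight_pos_survives by (intro pr_mono[OF local_event_survives descendants_subset])
  finally show ?thesis .
qed

end

section \<open>Extinction of a whole generation\<close>

context aged_tree
begin

definition generation :: "nat \<Rightarrow> 'a set" where
  "generation r = {v \<in> V. lev v = r}"

lemma generation_0: "generation 0 = {\<rho>}"
proof -
  have "v = \<rho>" if "v \<in> V" "lev v = 0" for v
    using lev_par[OF that(1)] that(2) by (cases "v = \<rho>") simp_all
  then show ?thesis
    using root unfolding generation_def by blast
qed

lemma generation_Suc: "generation (Suc r) = (\<Union>u\<in>generation r. children u)"
proof (intro subset_antisym subsetI)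
  fix v assume "v \<in> generation (Suc r)"
  then have v: "v \<in> V" "lev v = Suc r"
    by (auto simp: generation_def)
  then have "v \<noteq> \<rho>"
    using root by auto
  then show "v \<in> (\<Union>u\<in>generation r. children u)"
    using v par lev_par by (auto simp: generation_def children_def intro!: bexI[of _ "par v"])
qed (auto simp: generation_def dest: childrenD(1,2))

lemma generationD: "v \<in> generation r \<Longrightarrow> v \<in> V \<and> lev v = r"
  by (simp add: generation_def)

lemma finite_generation: "finite (generation r)"
proof (induction r)
  case (Suc r)
  then show ?case
    unfolding generation_Suc using generationD finite_children by blast
qed (simp add: generation_0)

lemma card_generation: "2 ^ r \<le> card (generation r)"
proof (induction r)
  case (Suc r)
  have "card (generation (Suc r)) = (\<Sum>u\<in>generation r. card (children u))"
    unfolding generation_Suc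
    by (intro card_UN_disjoint) (use finite_generation in \<open>auto simp: generation_def finite_children dest: childrenD(3)\<close>)
  also have "\<dots> \<ge> (\<Sum>u\<in>generation r. 2)"
    by (intro sum_mono two_children) (auto simp: generation_def)
  finally show ?case
    using Suc by simp
qed (simp add: generation_0)

text \<open>Survival is decided within subtrees, and those of distinct vertices at one level are
  disjoint, hence independent.\<close>

lemma pr_none_survives:
  assumes "finite W" "W \<subseteq> generation r"
  shows "pr (\<lambda>x. \<forall>w\<in>W. \<not> survives n w x) = (\<Prod>w\<in>W. 1 - pr (survives n w))"
  using assms
proof (induction W rule: finite_induct)
  case (insert w W)
  let ?S = "\<Union>v\<in>W. descendants v"
  have W: "w \<in> V" "lev w = r" "\<And>v. v \<in> W \<Longrightarrow> v \<in> V \<and> lev v = r"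
    using insert.prems by (auto simp: generation_def)
  have loc: "local_event (descendants w) (\<lambda>x. \<not> survives n w x)"
    by (intro local_event_not local_event_survives W)
  have "local_event ?S (\<lambda>x. \<not> survives n v x)" if "v \<in> W" for v
    using that W by (intro local_event_mono[OF local_event_not[OF local_event_survives]]) auto
  then have loc': "local_event ?S (\<lambda>x. \<forall>v\<in>W. \<not> survives n v x)"
    using insert.hyps by (intro local_event_ball)
  have dis: "descendants w \<inter> ?S = {}"
  proof -
    have "descendants w \<inter> descendants v = {}" if "v \<in> W" for v
      using that W insert.hyps(2) by (intro descendants_disjoint) auto
    then show ?thesis
      by blast
  qed
  have "pr (\<lambda>x. \<forall>v\<in>insert w W. \<not> survives n v x)
      = pr (\<lambda>x. \<not> survives n w x \<and> (\<forall>v\<in>W. \<not> survives n v x))"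
    by simp
  also have "\<dots> = pr (\<lambda>x. \<not> survives n w x) * pr (\<lambda>x. \<forall>v\<in>W. \<not> survives n v x)"
    using descendants_subset by (intro pr_conj[OF loc loc' dis]) auto
  also have "pr (\<lambda>x. \<not> survives n w x) = 1 - pr (survives n w)"
    by (intro pr_not[OF local_event_survives descendants_subset] W)
  finally show ?case
    using insert by simp
qed simp

lemma survives_mono: "survives n v x \<Longrightarrow> m \<le> n \<Longrightarrow> survives m v x"
proof (induction n arbitrary: m v)
  case (Suc n)
  then show ?case
    by (cases m) auto
qed simp

text \<open>With at least \<open>2 ^ r\<close> independent trials of success probability at least
  \<open>y\<close>, failure has probability at most \<open>exp (- (2 ^ r * y))\<close>, and the
  crude bound \<open>z \<le> exp z\<close> suffices to get geometric decay for
  \<open>a < 2\<close>.\<close>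

lemma pr_extinct_le:
  assumes G: "1 \<le> G" "1 \<le> a" and surv: "\<And>v. v \<in> V \<Longrightarrow> 1 / (G * a ^ lev v) \<le> pr (survives n v)"
  shows "pr (\<lambda>x. \<forall>w\<in>generation r. \<not> survives n w x) \<le> G * (a / 2) ^ r"
proof -
  define y where "y = 1 / (G * a ^ r)"
  have "1 * 1 \<le> G * a ^ r"
    using G by (intro mult_mono) (auto simp: one_le_power)
  then have y: "0 < y" "y \<le> 1"
    by (auto simp: y_def)
  have "pr (\<lambda>x. \<forall>w\<in>generation r. \<not> survives n w x) = (\<Prod>w\<in>generation r. 1 - pr (survives n w))"
    by (intro pr_none_survives[of _ r] finite_generation subset_refl)
  also have "\<dots> \<le> (\<Prod>w\<in>generation r. 1 - y)"
    using surv by (intro prod_mono) (auto simp: y_def generation_def)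
  also have "\<dots> \<le> (1 - y) ^ (2 ^ r)"
    using y card_generation by (simp add: power_decreasing)
  also have "\<dots> \<le> exp (- y) ^ (2 ^ r)"
    using y exp_ge_add_one_self[of "- y"] by (intro power_mono) auto
  also have "\<dots> = 1 / exp (2 ^ r * y)"
    using exp_of_nat_mult[of "2 ^ r" y] by (simp add: exp_minus power_inverse inverse_eq_divide power_one_over)
  also have "\<dots> \<le> 1 / (2 ^ r * y)"
  proof (intro divide_left_mono)
    show "2 ^ r * y \<le> exp (2 ^ r * y)"
      using exp_ge_add_one_self[of "2 ^ r * y"] by linarith
  qed (use y in auto)
  also have "\<dots> = G * (a / 2) ^ r"
    by (simp add: y_def power_divide)
  finally show ?thesis .
qed

text \<open>If no vertex survives all steps, then in every generation all lines are extinct after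
  finitely many steps. The probability of this for generation \<open>r\<close> tends to
  \<open>0\<close> as \<open>r\<close> grows.\<close>

lemma AE_survives:
  assumes a: "0 < C" "1 \<le> a" "3 / 4 * a\<^sup>2 < 1"
    and growth: "\<And>v. v \<in> V \<Longrightarrow> br v \<le> C * a ^ lev v"
  shows "AE \<omega> in M. \<exists>v\<in>V. \<forall>n. survives n v (\<lambda>i. X i \<omega>)"
proof -
  \<comment> \<open>The least value meeting both requirements of
    \<open>second_moment_le\<close>.\<close>
  define G where "G = max 1 (24 * C * a / (1 - 3 / 4 * a\<^sup>2))"
  have G: "1 \<le> G" "24 * C * a \<le> G * (1 - 3 / 4 * a\<^sup>2)"
  proof -
    have "24 * C * a / (1 - 3 / 4 * a\<^sup>2) \<le> G"
      by (simp add: G_def)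
    then show "24 * C * a \<le> G * (1 - 3 / 4 * a\<^sup>2)"
      using a(3) by (subst (asm) pos_divide_le_eq) auto
  qed (simp add: G_def)
  have "a < 2"
  proof (rule ccontr)
    assume "\<not> a < 2"
    then have "2\<^sup>2 \<le> a\<^sup>2"
      by (intro power_mono) auto
    then show False
      using a(3) by simp
  qed
  define D where "D r n = {\<omega> \<in> space M. \<forall>w\<in>generation r. \<not> survives n w (\<lambda>i. X i \<omega>)}" for r n
  have D: "D r n \<in> sets M" for r n
    unfolding D_def
    by (rule local_event_sets[of V], rule local_event_ball[OF finite_generation],
        rule local_event_mono[OF local_event_not[OF local_event_survives] descendants_subset])
      (auto simp: generation_def)
  \<comment> \<open>The events \<open>D r n\<close> increase with \<open>n\<close> because survival
    is decreasing in \<open>n\<close>, so continuity from below preserves the bound that is uniform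
    in \<open>n\<close>.\<close>
  have le: "measure M (\<Union>n. D r n) \<le> G * (a / 2) ^ r" for r
  proof (rule LIMSEQ_le_const2)
    show "(\<lambda>n. measure M (D r n)) \<longlonglongrightarrow> measure M (\<Union>n. D r n)"
      using D survives_mono by (intro finite_Lim_measure_incseq) (auto simp: incseq_def D_def)
    have "measure M (D r n) \<le> G * (a / 2) ^ r" for n
      using pr_extinct_le[OF G(1) a(2) pr_survives_ge[OF a growth G]] unfolding D_def pr_def by blast
    then show "\<exists>N. \<forall>n\<ge>N. measure M (D r n) \<le> G * (a / 2) ^ r"
      by blast
  qed
  define B where "B = (\<Inter>r. \<Union>n. D r n)"
  have B: "B \<in> sets M"
    using D unfolding B_def by auto
  have "measure M B \<le> G * (a / 2) ^ r" for r
  proof -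
    have "measure M B \<le> measure M (\<Union>n. D r n)"
      using D by (intro finite_measure_mono) (auto simp: B_def)
    then show ?thesis
      using le[of r] by simp
  qed
  moreover have "(\<lambda>r. G * (a / 2) ^ r) \<longlonglongrightarrow> G * 0"
    using \<open>a < 2\<close> a(2) by (intro tendsto_mult tendsto_const LIMSEQ_realpow_zero) auto
  ultimately have "measure M B \<le> 0"
    by (intro LIMSEQ_le_const[of "\<lambda>r. G * (a / 2) ^ r"]) auto
  then have "B \<in> null_sets M"
    using B by (auto simp: null_sets_def emeasure_eq_measure ennreal_eq_0_iff)
  moreover have "{\<omega> \<in> space M. \<not> (\<exists>v\<in>V. \<forall>n. survives n v (\<lambda>i. X i \<omega>))} \<subseteq> B"
  proof
    fix \<omega> assume \<omega>: "\<omega> \<in> {\<omega> \<in> space M. \<not> (\<exists>v\<in>V. \<forall>n. survives n v (\<lambda>i. X i \<omega>))}"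
    then obtain N where N: "\<And>v. v \<in> V \<Longrightarrow> \<not> survives (N v) v (\<lambda>i. X i \<omega>)"
      by (auto simp: bchoice_iff)
    show "\<omega> \<in> B"
      unfolding B_def
    proof
      fix r
      \<comment> \<open>Each vertex has its own extinction time \<open>N w\<close>; as the
        generation is finite, the maximum serves all of its vertices.\<close>
      have "\<not> survives (Max (N ` generation r)) w (\<lambda>i. X i \<omega>)" if w: "w \<in> generation r" for w
        using N[of w] survives_mono[of "Max (N ` generation r)" w _ "N w"] w finite_generation[of r]
        by (auto simp: generation_def)
      then show "\<omega> \<in> (\<Union>n. D r n)"
        using \<omega> by (auto simp: D_def)
    qed
  qed
  ultimately show ?thesis
    by (rule AE_I')
qed

end

section \<open>Rooted trees as graphs\<close>

lemma walk_conv_successively: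
  "walk V E p \<longleftrightarrow> p \<noteq> [] \<and> set p \<subseteq> V \<and> successively (\<lambda>u v. {u, v} \<in> E) p"
  by (auto simp: walk_def successively_conv_nth)

lemma walk_append:
  "walk V E p \<Longrightarrow> walk V E q \<Longrightarrow> {last p, hd q} \<in> E \<Longrightarrow> walk V E (p @ q)"
  by (auto simp: walk_conv_successively successively_append_iff)

lemma walk_rev: "walk V E p \<Longrightarrow> walk V E (rev p)"
  by (auto simp: walk_conv_successively successively_rev insert_commute)

lemma simple_graphD:
  assumes "simple_graph V E" "{u, v} \<in> E"
  shows "u \<in> V" "v \<in> V" "u \<noteq> v"
  using assms unfolding simple_graph_def by (metis doubleton_eq_iff)+

lemma geodesic:
  assumes "connected_graph V E" "u \<in> V" "v \<in> V"
  obtains p where "walk_between V E u p v" "length p = Suc (graph_dist V E u v)"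
proof -
  obtain p where p: "walk_between V E u p v"
    using assms by (auto simp: connected_graph_def)
  then have "length p = Suc (length p - 1)"
    by (cases p) (auto simp: walk_between_def walk_def)
  then have "\<exists>n p. walk_between V E u p v \<and> length p = Suc n"
    using p by blast
  from LeastI_ex[OF this] that show thesis
    unfolding graph_dist_def by blast
qed

lemma graph_dist_le: "walk_between V E u p v \<Longrightarrow> length p = Suc n \<Longrightarrow> graph_dist V E u v \<le> n"
  unfolding graph_dist_def by (rule Least_le) blast

lemma graph_dist_edge:
  assumes "simple_graph V E" "connected_graph V E" "w \<in> V" "{u, v} \<in> E"
  shows "graph_dist V E w v \<le> Suc (graph_dist V E w u)"
proof -
  note uv = simple_graphD[OF assms(1,4)]
  obtain p where p: "walk_between V E w p u" "length p = Suc (graph_dist V E w u)"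
    using geodesic[OF assms(2,3) uv(1)] .
  have "walk V E [v]"
    using uv by (simp add: walk_def)
  then have "walk V E (p @ [v])"
    using p(1) assms(4) by (intro walk_append) (auto simp: walk_between_def)
  then have "walk_between V E w (p @ [v]) v"
    using p(1) by (auto simp: walk_between_def walk_def)
  then show ?thesis
    using p(2) by (intro graph_dist_le) auto
qed

lemma graph_dist_self: "v \<in> V \<Longrightarrow> graph_dist V E v v = 0"
  using graph_dist_le[of V E v "[v]" v 0] by (simp add: walk_between_def walk_def)

text \<open>The last vertex but one of a shortest walk from \<open>w\<close> to \<open>v\<close>
  works: the shortened walk gives one inequality, the edge gives the other.\<close>

lemma closer_neighbour:
  assumes "simple_graph V E" "connected_graph V E" "w \<in> V" "v \<in> V" "v \<noteq> w"
  shows "\<exists>u. {u, v} \<in> E \<and> graph_dist V E w v = Suc (graph_dist V E w u)"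
proof -
  obtain p where p: "walk_between V E w p v" "length p = Suc (graph_dist V E w v)"
    using geodesic[OF assms(2-4)] .
  define q where "q = butlast p"
  have pq: "p = q @ [v]"
    using p by (auto simp: q_def walk_between_def walk_def intro: append_butlast_last_id[symmetric])
  have q: "q \<noteq> []"
    using p(1) assms(5) by (auto simp: pq walk_between_def)
  have "walk_between V E w q (last q)" and e: "{last q, v} \<in> E"
    using p(1) q by (auto simp: pq walk_between_def walk_conv_successively successively_append_iff)
  moreover have "length q = Suc (graph_dist V E w v - 1)" "0 < graph_dist V E w v"
    using p(2) q by (auto simp: pq neq_Nil_conv)
  ultimately have "Suc (graph_dist V E w (last q)) \<le> graph_dist V E w v"
    using graph_dist_le[of V E w q "last q" "graph_dist V E w v - 1"] by linarith
  then show ?thesis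
    using e graph_dist_edge[OF assms(1-3) e] by (intro exI[of _ "last q"]) auto
qed

text \<open>An arbitrary choice here; for a rooted tree seen from its root,
  \<open>neighbours_rooted_tree\<close> later shows that no other neighbour is closer.\<close>

definition closer :: "'a set \<Rightarrow> 'a set set \<Rightarrow> 'a \<Rightarrow> 'a \<Rightarrow> 'a" where
  "closer V E w v = (SOME u. {u, v} \<in> E \<and> graph_dist V E w v = Suc (graph_dist V E w u))"

lemma closer:
  assumes "rooted_tree V E \<rho>" "v \<in> V" "v \<noteq> \<rho>"
  shows "{closer V E \<rho> v, v} \<in> E" "graph_dist V E \<rho> v = Suc (graph_dist V E \<rho> (closer V E \<rho> v))"
    "closer V E \<rho> v \<in> V"
proof -
  have *: "simple_graph V E" "connected_graph V E" "\<rho> \<in> V"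
    using assms by (auto simp: rooted_tree_def tree_def)
  note someI_ex[OF closer_neighbour[OF * assms(2,3)], folded closer_def]
  then show "{closer V E \<rho> v, v} \<in> E" "graph_dist V E \<rho> v = Suc (graph_dist V E \<rho> (closer V E \<rho> v))"
    by auto
  then show "closer V E \<rho> v \<in> V"
    using simple_graphD[OF *(1)] by blast
qed

lemma parent_tree_closer:
  assumes "rooted_tree V E \<rho>"
  shows "parent_tree V \<rho> (closer V E \<rho>) (graph_dist V E \<rho>)"
proof -
  have "\<rho> \<in> V"
    using assms by (simp add: rooted_tree_def)
  then show ?thesis
    by (intro parent_tree.intro graph_dist_self closer(2,3)[OF assms])
qed

section \<open>Every edge joins a vertex to its parent\<close>

context parent_tree
begin

lemma ancestor:
  "v \<in> V \<Longrightarrow> k \<le> lev v \<Longrightarrow> (par ^^ k) v \<in> V \<and> lev ((par ^^ k) v) + k = lev v"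
proof (induction k)
  case (Suc k)
  then have *: "(par ^^ k) v \<in> V" "lev ((par ^^ k) v) + k = lev v"
    by auto
  then have "(par ^^ k) v \<noteq> \<rho>"
    using Suc.prems root by auto
  then show ?case
    using * par[OF *(1)] lev_par[OF *(1)] by auto
qed simp

lemma lev_0: "v \<in> V \<Longrightarrow> lev v = 0 \<Longrightarrow> v = \<rho>"
  using lev_par by (metis nat.distinct(1))

lemma walk_ancestors:
  assumes "v \<in> V" "k \<le> lev v" and edge: "\<And>u. u \<in> V \<Longrightarrow> u \<noteq> \<rho> \<Longrightarrow> {par u, u} \<in> E"
  shows "walk V E (map (\<lambda>i. (par ^^ i) v) [0..<Suc k])"
  unfolding walk_def
proof (intro conjI allI impI)
  show "set (map (\<lambda>i. (par ^^ i) v) [0..<Suc k]) \<subseteq> V"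
    using ancestor[OF assms(1)] assms(2) by auto
  fix i assume "Suc i < length (map (\<lambda>i. (par ^^ i) v) [0..<Suc k])"
  then have i: "Suc i \<le> k"
    by simp
  have "(par ^^ i) v \<in> V" "lev ((par ^^ i) v) \<noteq> 0"
    using ancestor[OF assms(1), of i] assms(2) i by auto
  then have "{par ((par ^^ i) v), (par ^^ i) v} \<in> E"
    using edge root by metis
  then show "{map (\<lambda>i. (par ^^ i) v) [0..<Suc k] ! i, map (\<lambda>i. (par ^^ i) v) [0..<Suc k] ! Suc i} \<in> E"
    using i by (simp add: insert_commute del: upt_Suc)
qed simp

lemma inj_ancestors:
  assumes "v \<in> V" "k \<le> lev v"
  shows "inj_on (\<lambda>i. (par ^^ i) v) {..k}"
proof (rule inj_onI)
  fix i j assume ij: "i \<in> {..k}" "j \<in> {..k}" "(par ^^ i) v = (par ^^ j) v"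
  then show "i = j"
    using ancestor[OF assms(1), of i] ancestor[OF assms(1), of j] assms(2) by auto
qed

text \<open>
  An edge outside the parent relation would close a cycle together with the two ancestral lines
  of its endpoints, up to where they first meet.
\<close>

lemma edge_parent:
  assumes acyclic: "\<nexists>p. cycle V E p" and edge: "\<And>u. u \<in> V \<Longrightarrow> u \<noteq> \<rho> \<Longrightarrow> {par u, u} \<in> E"
    and xy: "{x, y} \<in> E" "x \<in> V" "y \<in> V" "x \<noteq> y"
  shows "x \<noteq> \<rho> \<and> par x = y \<or> y \<noteq> \<rho> \<and> par y = x"
proof (rule ccontr)
  assume no: "\<not> ?thesis"
  let ?x = "\<lambda>i. (par ^^ i) x" and ?y = "\<lambda>i. (par ^^ i) y"
  define P where "P i j \<longleftrightarrow> i \<le> lev x \<and> j \<le> lev y \<and> ?x i = ?y j" for i j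
  have "?x (lev x) = \<rho>" "?y (lev y) = \<rho>"
    using ancestor[OF xy(2), of "lev x"] ancestor[OF xy(3), of "lev y"] lev_0 by auto
  then have "P (lev x) (lev y)"
    by (simp add: P_def)
  \<comment> \<open>Minimising \<open>i + j\<close> picks the first meeting of the two ancestral
    lines.\<close>
  then obtain i j where ij: "P i j" and min: "\<And>k l. P k l \<Longrightarrow> i + j \<le> k + l"
    using exists_least_iff[of "\<lambda>n. \<exists>i j. P i j \<and> n = i + j"] by (metis not_le_imp_less)
  have ij': "i \<le> lev x" "j \<le> lev y" "?x i = ?y j"
    using ij by (auto simp: P_def)
  \<comment> \<open>\<open>?q\<close> stops short of the meeting vertex, which already ends
    \<open>?p\<close>. The list has \<open>i + 1 + j\<close> entries, so \<open>long\<close> below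
    supplies the length required of a cycle.\<close>
  let ?p = "map ?x [0..<Suc i]" and ?q = "rev (map ?y [0..<j])"
  have long: "2 \<le> i + j"
  proof (rule ccontr)
    assume "\<not> 2 \<le> i + j"
    then consider "i = 0" "j = 0" | "i = 1" "j = 0" | "i = 0" "j = 1"
      by linarith
    then show False
    proof cases
      case 1
      then show ?thesis
        using ij' xy by simp
    next
      case 2
      then show ?thesis
        using ij' no root by auto
    next
      case 3
      then show ?thesis
        using ij' no root by auto
    qed
  qed
  have "walk V E (?p @ ?q)"
  proof (cases j)
    case 0
    then show ?thesis
      using walk_ancestors[OF xy(2) ij'(1) edge] by simp
  next
    case (Suc k)
    have k: "k \<le> lev y"
      using Suc ij' by simp
    have q: "walk V E ?q"
      using walk_rev[OF walk_ancestors[OF xy(3) k edge]] Suc by simp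
    have "(par ^^ k) y \<in> V" "lev ((par ^^ k) y) \<noteq> 0"
      using ancestor[OF xy(3), of k] k Suc ij' by auto
    then have "{par (?y k), ?y k} \<in> E"
      using edge root by metis
    then have "{last ?p, hd ?q} \<in> E"
      using Suc ij' by (simp add: hd_rev last_map)
    then show ?thesis
      using walk_ancestors[OF xy(2) ij'(1) edge] q by (intro walk_append)
  qed
  moreover have "distinct (?p @ ?q)"
  proof -
    have "distinct ?p" "distinct ?q"
      using inj_ancestors[OF xy(2) ij'(1)] inj_ancestors[OF xy(3) ij'(2)]
      by (auto simp: distinct_map simp del: upt_Suc elim!: inj_on_subset)
    \<comment> \<open>A vertex common to both pieces would be an earlier meeting, against
      minimality.\<close>
    moreover have False if "k \<le> i" "l < j" "?x k = ?y l" for k l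
      using min[of k l] that ij' by (simp add: P_def)
    ultimately show ?thesis
      by (auto simp del: upt_Suc simp: less_Suc_eq_le)
  qed
  moreover have "hd (?p @ ?q) = x"
    by (simp add: upt_rec del: upt_Suc)
  moreover have "last (?p @ ?q) = y"
  proof (cases j)
    case 0
    then show ?thesis
      using ij' by simp
  next
    case (Suc k)
    then show ?thesis
      by (simp add: last_rev upt_rec[of 0] del: upt_Suc)
  qed
  ultimately have "cycle V E (?p @ ?q)"
    using long xy(1) unfolding cycle_def by (simp add: insert_commute)
  then show False
    using acyclic by blast
qed

end

text \<open>The bridge between the graph and the parent function: \<open>edge_parent\<close> rules
  out any further neighbours.\<close>

lemma neighbours_rooted_tree:
  assumes tree: "rooted_tree V E \<rho>" and v: "v \<in> V"
  shows "neighbours E v = parent_tree.children V \<rho> (closer V E \<rho>) v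
    \<union> (if v = \<rho> then {} else {closer V E \<rho> v})"
proof -
  interpret parent_tree V \<rho> "closer V E \<rho>" "graph_dist V E \<rho>"
    using parent_tree_closer[OF tree] .
  have E: "simple_graph V E" "\<nexists>p. cycle V E p"
    using tree by (auto simp: rooted_tree_def tree_def)
  note edge = closer(1)[OF tree]
  have "u \<in> neighbours E v \<longleftrightarrow> u \<in> children v \<or> v \<noteq> \<rho> \<and> u = closer V E \<rho> v" for u
  proof
    assume "u \<in> neighbours E v"
    then have uv: "{u, v} \<in> E"
      by (simp add: neighbours_def)
    from edge_parent[OF E(2) edge uv] simple_graphD[OF E(1) uv]
    show "u \<in> children v \<or> v \<noteq> \<rho> \<and> u = closer V E \<rho> v"
      by (auto simp: children_def)
  next
    assume "u \<in> children v \<or> v \<noteq> \<rho> \<and> u = closer V E \<rho> v"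
    then show "u \<in> neighbours E v"
      using edge[of u] edge[of v] v by (auto simp: neighbours_def children_def insert_commute)
  qed
  then show ?thesis
    by auto
qed

text \<open>The third layer tolerates \<open>3 - 1 = 2\<close> younger neighbours; \<open>p\<close>
  and \<open>q\<close> may coincide.\<close>

lemma layers_3I:
  assumes "v \<in> V" "{u \<in> neighbours E v. x u < x v} \<subseteq> {p, q}"
  shows "v \<in> layers V E 3 x"
proof -
  have "card {u \<in> neighbours E v. x u < x v} \<le> card {p, q}"
    using assms(2) by (intro card_mono) auto
  also have "\<dots> \<le> 2"
    by (simp add: card_insert_if)
  finally show ?thesis
    using assms finite_subset[OF assms(2)] by (auto simp: layers_def)
qed

text \<open>\<open>p\<close> is a neighbour of unknown age outside the controlled set
  \<open>B\<close>, and \<open>q\<close> is the one exception within \<open>B\<close>.\<close>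

lemma younger_subset:
  fixes x :: "'a \<Rightarrow> real"
  assumes "A \<subseteq> insert p B" "\<And>y. y \<in> B \<Longrightarrow> y \<noteq> q \<Longrightarrow> c < x y"
  shows "{y \<in> A. x y < c} \<subseteq> {p, q}"
proof
  fix y assume "y \<in> {y \<in> A. x y < c}"
  then have "y = p \<or> y \<in> B" "\<not> c < x y"
    using assms(1) by auto
  then show "y \<in> {p, q}"
    using assms(2) by blast
qed

section \<open>From surviving paths to an infinite component\<close>

context aged_tree
begin

text \<open>For \<open>v\<close> the possible younger neighbours are its parent and one of
  \<open>u\<close>, \<open>f\<close>; for \<open>u\<close> they are \<open>w\<close> and one of
  \<open>v\<close>, \<open>h\<close>. A younger child \<open>f\<close> of \<open>v\<close> comes
  only with \<open>u\<close> older than \<open>v\<close>, and \<open>h\<close> only with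
  \<open>v\<close> older than \<open>u\<close>.\<close>

lemma step_layers:
  assumes nb: "\<And>v. v \<in> V \<Longrightarrow> neighbours E v = children v \<union> (if v = \<rho> then {} else {par v})"
    and v: "v \<in> V" and u: "u \<in> children v" and w: "w \<in> children u" and step: "step v u w x"
  shows "v \<in> layers V E 3 x" "u \<in> layers V E 3 x"
proof -
  have uV: "u \<in> V" "u \<noteq> \<rho>" "par u = v"
    using u by (auto simp: children_def)
  \<comment> \<open>At the root \<open>par v\<close> is an arbitrary element, but only an inclusion
    is claimed.\<close>
  have nv: "neighbours E v \<subseteq> insert (par v) (insert u (children v - {u}))"
    using nb[OF v] u by auto
  have nu: "neighbours E u \<subseteq> insert v (insert w (children u - {w}))"
    using nb[OF uV(1)] uV(2,3) by auto
  then have nu': "neighbours E u \<subseteq> insert w (insert v (children u - {w}))"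
    by blast
  from step consider
      "\<forall>j\<in>children v - {u}. x v < x j" "\<forall>j\<in>children u - {w}. x u < x j"
    | f where "\<forall>j\<in>children v - {u} - {f}. x v < x j" "x v < x u" "\<forall>j\<in>children u - {w}. x u < x j"
    | h where "\<forall>j\<in>children u - {w} - {h}. x u < x j" "x u < x v" "\<forall>j\<in>children v - {u}. x v < x j"
    unfolding step_def block_def by blast
  then have "(\<exists>p q. {y \<in> neighbours E v. x y < x v} \<subseteq> {p, q}) \<and> (\<exists>p q. {y \<in> neighbours E u. x y < x u} \<subseteq> {p, q})"
  proof cases
    case 1
    have "{y \<in> neighbours E v. x y < x v} \<subseteq> {par v, u}"
      by (rule younger_subset[OF nv]) (use 1 in blast)
    moreover have "{y \<in> neighbours E u. x y < x u} \<subseteq> {v, w}"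
      by (rule younger_subset[OF nu]) (use 1 in blast)
    ultimately show ?thesis
      by blast
  next
    case (2 f)
    have "{y \<in> neighbours E v. x y < x v} \<subseteq> {par v, f}"
      by (rule younger_subset[OF nv]) (use 2 in blast)
    moreover have "{y \<in> neighbours E u. x y < x u} \<subseteq> {v, w}"
      by (rule younger_subset[OF nu]) (use 2 in blast)
    ultimately show ?thesis
      by blast
  next
    case (3 h)
    have "{y \<in> neighbours E v. x y < x v} \<subseteq> {par v, u}"
      by (rule younger_subset[OF nv]) (use 3 in blast)
    moreover have "{y \<in> neighbours E u. x y < x u} \<subseteq> {w, h}"
      by (rule younger_subset[OF nu']) (use 3 in blast)
    ultimately show ?thesis
      by blast
  qed
  then show "v \<in> layers V E 3 x" "u \<in> layers V E 3 x"
    using layers_3I v uV(1) by metis+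
qed

text \<open>Survival of \<open>Suc n\<close> steps rather than \<open>n\<close>, because the last
  vertex of the walk lies in the layer only through the step that starts there. Each earlier step
  descends two levels, so the stated gain of \<open>n\<close> levels is generous.\<close>

lemma survives_walk:
  assumes nb: "\<And>v. v \<in> V \<Longrightarrow> neighbours E v = children v \<union> (if v = \<rho> then {} else {par v})"
    and W: "W = layers V E 3 x"
  shows "v \<in> V \<Longrightarrow> survives (Suc n) v x \<Longrightarrow>
    \<exists>p y. walk_between W (induced_edges E W) v p y \<and> lev v + n \<le> lev y"
proof (induction n arbitrary: v)
  case 0
  then obtain u w where uw: "u \<in> children v" "w \<in> children u" "step v u w x"
    by auto
  then have "v \<in> W"
    using step_layers(1)[OF nb 0(1) uw] W by simp
  then have "walk_between W (induced_edges E W) v [v] v"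
    by (simp add: walk_between_def walk_def)
  then show ?case
    by (intro exI[of _ "[v]"] exI[of _ v]) simp
next
  case (Suc n)
  from Suc.prems(2) obtain u w where uw: "u \<in> children v" "w \<in> children u" "step v u w x"
      and s: "survives (Suc n) w x"
    unfolding survives.simps(2)[of "Suc n"] by blast
  obtain p y where p: "walk_between W (induced_edges E W) w p y" "lev w + n \<le> lev y"
    using Suc.IH[OF childrenD(1)[OF uw(2)] s] by blast
  have p': "walk W (induced_edges E W) p" "hd p = w" "last p = y" "p \<noteq> []" "w \<in> W"
    using p(1) by (auto simp: walk_between_def walk_def)
  have W': "v \<in> W" "u \<in> W"
    using step_layers[OF nb Suc.prems(1) uw] W by auto
  have "u \<in> neighbours E v" "w \<in> neighbours E u"
    using nb[OF Suc.prems(1)] nb[OF childrenD(1)[OF uw(1)]] uw(1,2) by auto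
  then have e: "{v, u} \<in> induced_edges E W" "{u, w} \<in> induced_edges E W"
    using W' p'(5) by (auto simp: neighbours_def induced_edges_def insert_commute)
  have "walk W (induced_edges E W) ([v, u] @ p)"
    using e W' p' by (intro walk_append) (auto simp: walk_conv_successively)
  then have "walk_between W (induced_edges E W) v ([v, u] @ p) y"
    using p' by (simp add: walk_between_def)
  moreover have "lev v + Suc n \<le> lev y"
    using p(2) childrenD(2)[OF uw(1)] childrenD(2)[OF uw(2)] by simp
  ultimately show ?case
    by blast
qed

text \<open>The component of \<open>v\<close> meets arbitrarily deep levels, so its image under
  \<open>lev\<close> is infinite.\<close>

lemma survives_infinite_component:
  assumes nb: "\<And>v. v \<in> V \<Longrightarrow> neighbours E v = children v \<union> (if v = \<rho> then {} else {par v})"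
    and W: "W = layers V E 3 x" and v: "v \<in> V" "\<And>n. survives n v x"
  shows "\<exists>K\<in>graph_components W (induced_edges E W). infinite K"
proof -
  define K where "K = {u. \<exists>p. walk_between W (induced_edges E W) v p u}"
  note far = survives_walk[OF nb W v(1) v(2)]
  have "\<exists>y\<in>K. n \<le> lev y" for n
    using far[of n] unfolding K_def by (blast intro: order_trans[OF le_add2])
  then have "infinite (lev ` K)"
    unfolding infinite_nat_iff_unbounded_le by blast
  then have "infinite K"
    using finite_imageI by blast
  moreover have "v \<in> W"
    using far[of 0] by (auto simp: walk_between_def walk_def)
  ultimately show ?thesis
    unfolding graph_components_def K_def by blast
qed

end

theorem theorem1:
  fixes V :: "'a set" and E :: "'a set set" and \<rho> :: 'a
    and M :: "'b measure" and X :: "'a \<Rightarrow> 'b \<Rightarrow> real"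
    and C a :: real
  assumes "rooted_tree V E \<rho>"
    and "\<And>v. v \<in> V \<Longrightarrow> finite (neighbours E v) \<and> 3 \<le> vertex_degree E v"
    and "prob_space M"
    and "iid_uniform M V X"
    and "C > 0" and "1 \<le> a" and "a < sqrt (4 / 3)"
    and "\<And>r. real (Max (vertex_degree E ` level V E \<rho> r)) \<le> C * a ^ r"
  shows "AE \<omega> in M. let W = layers V E 3 (\<lambda>v. X v \<omega>) in
           \<exists>K \<in> graph_components W (induced_edges E W). infinite K"
proof -
  let ?par = "closer V E \<rho>" and ?lev = "graph_dist V E \<rho>"
  note nb = neighbours_rooted_tree[OF assms(1)]
  interpret parent_tree V \<rho> ?par ?lev
    using parent_tree_closer[OF assms(1)] .
  \<comment> \<open>At most one of the at least three neighbours is the parent, which leaves two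
    children.\<close>
  have deg: "children v \<subseteq> neighbours E v" "finite (neighbours E v)" "2 \<le> card (children v)" if "v \<in> V" for v
  proof -
    show fin: "children v \<subseteq> neighbours E v" "finite (neighbours E v)"
      using nb[OF that] assms(2)[OF that] by auto
    have "neighbours E v \<subseteq> insert (?par v) (children v)"
      using nb[OF that] by auto
    then have "card (neighbours E v) \<le> card (insert (?par v) (children v))"
      using fin by (intro card_mono finite.insertI finite_subset[OF fin])
    also have "\<dots> \<le> Suc (card (children v))"
      by (simp add: card_insert_le_m1 card_insert_if)
    finally show "2 \<le> card (children v)"
      using assms(2)[OF that] by (simp add: vertex_degree_def)
  qed
  interpret prob_space M
    by fact
  interpret aged_tree V \<rho> ?par ?lev M X
  proof unfold_locales
    show "indep_vars (\<lambda>_. borel) X V"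
      using assms(4) by (simp add: iid_uniform_def)
    show "distr M borel (X v) = uniform_measure lborel {0..1}" if "v \<in> V" for v
      using assms(4) that by (simp add: iid_uniform_def)
    show "finite (children v)" if "v \<in> V" for v
      using deg[OF that] finite_subset by blast
  qed (rule deg)
  have "AE \<omega> in M. \<exists>v\<in>V. \<forall>n. survives n v (\<lambda>i. X i \<omega>)"
  proof (rule AE_survives[OF assms(5,6)])
    \<comment> \<open>The growth condition on \<open>a\<close> is exactly what makes two generations
      contract.\<close>
    have "a\<^sup>2 < (sqrt (4 / 3))\<^sup>2"
      using assms(6,7) by (intro power_strict_mono) auto
    then show "3 / 4 * a\<^sup>2 < 1"
      by simp
    fix v assume v: "v \<in> V"
    have level: "level V E \<rho> (?lev v) = generation (?lev v)"
      by (simp add: level_def generation_def)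
    have "card (children v) \<le> vertex_degree E v"
      unfolding vertex_degree_def using deg[OF v] by (intro card_mono)
    also have "\<dots> \<le> Max (vertex_degree E ` level V E \<rho> (?lev v))"
      \<comment> \<open>Levels are finite, so \<open>Max\<close> really bounds the degrees in
        them.\<close>
      using v finite_generation unfolding level by (intro Max_ge) (auto simp: generation_def)
    finally have "br v \<le> real (Max (vertex_degree E ` level V E \<rho> (?lev v)))"
      by (simp add: br_def)
    then show "br v \<le> C * a ^ ?lev v"
      using assms(8)[of "?lev v"] by linarith
  qed
  then show ?thesis
  proof eventually_elim
    case (elim \<omega>)
    then obtain v where v: "v \<in> V" "\<And>n. survives n v (\<lambda>i. X i \<omega>)"
      by blast
    show ?case
      unfolding Let_def by (rule survives_infinite_component[OF nb refl v])
  qed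
qed

end
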